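(* Stallings' group $$G=\langle a,b,c,d,s \mid [a,c]=[a,d]=[b,c]=[b,d]=1,\ [s,ab^{-1}]=[s,ac^{-1}]=[s,ad^{-1}]=1\rangle$$ is autostackable.
   Context: A group is autostackable if it is autostackable over some finite inverse-closed generating set, as defined below. Conventions. All generating sets are finite and inverse-closed; no element of a generating set represents the identity, and distinct elements represent distinct group elements. $A^*$ is the set of all finite words over $A$; for $a\in A$, $a^{-1}$ denotes the letter of $A$ representing the inverse of $a$. Flow functions. Let $G$ be a group with finite inverse-closed generating set $A$ and Cayley graph $\Gamma=\Gamma(G,A)$. Let $\vec E$ be the set of directed edges and $\vec P$ the set of directed edge paths of $\Gamma$. For $g\in G$, $a\in A$, $e_{g,a}$ is the directed edge from $g$ to $ga$ labeled $a$; the directed edges $e_{g,a}$ and $e_{ga,a^{-1}}$ have the same underlying undirected edge. A flow function associated to a maximal tree $\mathcal T$ in $\Gamma$ is a function $\Phi:\vec E\to\vec P$ such that: (F1) for each $e\in\vec E$, the path $\Phi(e)$ has the same initial and terminal vertices as $e$; (F2d) if the undirected edge underlying $e$ lies in $\mathcal T$, then $\Phi(e)=e$; (F2r) the transitive closure $<_\Phi$ of the relation $<$ on $\vec E$, defined by $e'<e$ whenever $e'$ lies on the path $\Phi(e)$ and the undirected edges underlying both $e$ and $e'$ do not lie in $\mathcal T$, is a well-founded strict partial ordering. $\Phi$ is bounded if there is a constant $k$ such that for all $e\in\vec E$ the path $\Phi(e)$ has length at most $k$. Stacking map. For $g\in G$ let $y_g\in A^*$ be the label of the unique path without backtracking in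 $\mathcal T$ from the identity to $g$, and let $\mathcal N=\{y_g\mid g\in G\}$. The stacking map of $\Phi$ is $\phi:\mathcal N\times A\to A^*$, where $\phi(y_g,a)$ is the word labeling the path $\Phi(e_{g,a})$. Its graph is $graph(\phi)=\{(y_g,a,\phi(y_g,a))\mid g\in G,\ a\in A\}\subseteq (A^* )^3$. Definition. $G$ is autostackable over $A$ if it has a bounded flow function (associated to some maximal tree in $\Gamma(G,A)$) for which $graph(\phi)$ is synchronously regular. Synchronously regular languages. Let $\$\notin A$ and let $A_n=(A\cup\{\$\})^n\setminus\{(\$,\dots,\$)\}$. For $u=(u_1,\dots,u_n)\in(A^* )^n$, append symbols $\$$ at the end of each $u_i$ to make all components have length $M=\max_i \ell(u_i)$, and let $\mu(u)\in A_n^*$ be the word of length $M$ whose $m$-th letter is the $n$-tuple of $m$-th letters of the padded components. A subset $L\subseteq(A^* )^n$ is synchronously regular if $\{\mu(u)\mid u\in L\}$ is a regular language over $A_n$. *)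

theory Defs
  imports
    "HOL-Algebra.Generated_Groups"
    "Graph_Theory.Digraph_Component"
begin

section \<open>Group presentations\<close>

text \<open>
  A letter \<open>(x, False)\<close> stands for the generator \<open>x\<close>, and \<open>(x, True)\<close> for its formal inverse.
\<close>

type_synonym 'x gword = "('x \<times> bool) list"

abbreviation flip_letter :: "'x \<times> bool \<Rightarrow> 'x \<times> bool" where
  "flip_letter l \<equiv> (fst l, \<not> snd l)"

definition inv_word :: "'x gword \<Rightarrow> 'x gword" where
  "inv_word w = rev (map flip_letter w)"

definition gen_word :: "'x \<Rightarrow> 'x gword" where
  "gen_word x = [(x, False)]"

definition commutator_word :: "'x gword \<Rightarrow> 'x gword \<Rightarrow> 'x gword" where
  "commutator_word u v = u @ v @ inv_word u @ inv_word v"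

text \<open>
  Equality in the group \<open>\<langle>X | R\<rangle>\<close>, with \<open>X\<close> the whole type \<open>'x\<close>: the congruence on words generated
  by free cancellation and by \<open>r = 1\<close> for all relators \<open>r \<in> R\<close>.
\<close>

inductive pres_eq :: "'x gword set \<Rightarrow> 'x gword \<Rightarrow> 'x gword \<Rightarrow> bool" for R where
  refl: "pres_eq R u u"
| sym: "pres_eq R u v \<Longrightarrow> pres_eq R v u"
| trans: "pres_eq R u v \<Longrightarrow> pres_eq R v w \<Longrightarrow> pres_eq R u w"
| cancel: "pres_eq R (u @ [l, flip_letter l] @ v) (u @ v)"
| relator: "r \<in> R \<Longrightarrow> pres_eq R (u @ r @ v) (u @ v)"

definition pres_class :: "'x gword set \<Rightarrow> 'x gword \<Rightarrow> 'x gword set" where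
  "pres_class R u = {v. pres_eq R u v}"

definition presented_group :: "'x gword set \<Rightarrow> 'x gword set monoid" where
  "presented_group R =
    \<lparr> carrier = range (pres_class R),
      monoid.mult = (\<lambda>X Y. {w. \<exists>u\<in>X. \<exists>v\<in>Y. pres_eq R (u @ v) w}),
      one = pres_class R [] \<rparr>"

lemma pres_eq_append_left: "pres_eq R u v \<Longrightarrow> pres_eq R (w @ u) (w @ v)"
proof (induction rule: pres_eq.induct)
  case (cancel u l v)
  then show ?case using pres_eq.cancel[of R "w @ u" l v] by simp
next
  case (relator r u v)
  then show ?case using pres_eq.relator[of r R "w @ u" v] by simp
qed (blast intro: pres_eq.intros)+

lemma pres_eq_append_right: "pres_eq R u v \<Longrightarrow> pres_eq R (u @ w) (v @ w)"
proof (induction rule: pres_eq.induct)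
  case (cancel u l v)
  then show ?case using pres_eq.cancel[of R u l "v @ w"] by simp
next
  case (relator r u v)
  then show ?case using pres_eq.relator[of r R u "v @ w"] by simp
qed (blast intro: pres_eq.intros)+

lemma pres_eq_append:
  "pres_eq R u u' \<Longrightarrow> pres_eq R v v' \<Longrightarrow> pres_eq R (u @ v) (u' @ v')"
  by (meson pres_eq.trans pres_eq_append_left pres_eq_append_right)

lemma pres_class_eq_iff: "pres_class R u = pres_class R v \<longleftrightarrow> pres_eq R u v"
  unfolding pres_class_def
  by (metis (mono_tags, lifting) Collect_cong mem_Collect_eq pres_eq.refl pres_eq.sym pres_eq.trans)

lemma presented_group_mult:
  "pres_class R u \<otimes>\<^bsub>presented_group R\<^esub> pres_class R v = pres_class R (u @ v)"
  unfolding presented_group_def pres_class_def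
  by (auto intro: pres_eq.refl pres_eq.sym pres_eq.trans pres_eq_append)

lemma pres_eq_inv_left: "pres_eq R (inv_word u @ u) []"
proof (induction u)
  case Nil
  then show ?case by (simp add: inv_word_def pres_eq.refl)
next
  case (Cons l u)
  have "pres_eq R (inv_word u @ [flip_letter l, flip_letter (flip_letter l)] @ u) (inv_word u @ u)"
    by (rule pres_eq.cancel)
  then have "pres_eq R (inv_word (l # u) @ (l # u)) (inv_word u @ u)"
    by (simp add: inv_word_def)
  then show ?case using Cons pres_eq.trans by blast
qed

lemma group_presented_group: "group (presented_group R)"
proof (rule groupI)
  fix x assume "x \<in> carrier (presented_group R)"
  then obtain u where u: "x = pres_class R u" by (auto simp: presented_group_def)
  have 1: "\<one>\<^bsub>presented_group R\<^esub> = pres_class R []" by (simp add: presented_group_def)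
  show "\<one>\<^bsub>presented_group R\<^esub> \<otimes>\<^bsub>presented_group R\<^esub> x = x"
    by (simp add: u 1 presented_group_mult)
  have "pres_class R (inv_word u) \<otimes>\<^bsub>presented_group R\<^esub> x = \<one>\<^bsub>presented_group R\<^esub>"
    by (simp add: u 1 presented_group_mult pres_class_eq_iff pres_eq_inv_left)
  then show "\<exists>y\<in>carrier (presented_group R). y \<otimes>\<^bsub>presented_group R\<^esub> x = \<one>\<^bsub>presented_group R\<^esub>"
    by (auto simp: presented_group_def)
next
  fix x y assume "x \<in> carrier (presented_group R)" "y \<in> carrier (presented_group R)"
  then obtain u v where "x = pres_class R u" "y = pres_class R v"
    by (auto simp: presented_group_def)
  then show "x \<otimes>\<^bsub>presented_group R\<^esub> y \<in> carrier (presented_group R)"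
    by (simp add: presented_group_mult) (simp add: presented_group_def)
next
  fix x y z
  assume "x \<in> carrier (presented_group R)" "y \<in> carrier (presented_group R)"
    "z \<in> carrier (presented_group R)"
  then obtain u v w where "x = pres_class R u" "y = pres_class R v" "z = pres_class R w"
    by (auto simp: presented_group_def)
  then show "x \<otimes>\<^bsub>presented_group R\<^esub> y \<otimes>\<^bsub>presented_group R\<^esub> z =
      x \<otimes>\<^bsub>presented_group R\<^esub> (y \<otimes>\<^bsub>presented_group R\<^esub> z)"
    by (simp add: presented_group_mult)
qed (auto simp: presented_group_def)


section \<open>Stallings' group\<close>

datatype stallings_gen = Sa | Sb | Sc | Sd | Ss

definition stallings_relators :: "stallings_gen gword set" where
  "stallings_relators =
    {commutator_word (gen_word Sa) (gen_word Sc),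
     commutator_word (gen_word Sa) (gen_word Sd),
     commutator_word (gen_word Sb) (gen_word Sc),
     commutator_word (gen_word Sb) (gen_word Sd),
     commutator_word (gen_word Ss) (gen_word Sa @ inv_word (gen_word Sb)),
     commutator_word (gen_word Ss) (gen_word Sa @ inv_word (gen_word Sc)),
     commutator_word (gen_word Ss) (gen_word Sa @ inv_word (gen_word Sd))}"

definition stallings_group :: "stallings_gen gword set monoid" where
  "stallings_group = presented_group stallings_relators"


section \<open>Cayley graphs and maximal trees\<close>

text \<open>
  Generating sets are subsets of the group, so distinct letters are distinct group elements, and the
  letter \<open>a\<^sup>-\<^sup>1\<close> is the inverse of \<open>a\<close> in \<open>G\<close>.
\<close>

definition inverse_closed_generating_set :: "('g, 'm) monoid_scheme \<Rightarrow> 'g set \<Rightarrow> bool" where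
  "inverse_closed_generating_set G A \<longleftrightarrow>
    finite A \<and> A \<subseteq> carrier G \<and> \<one>\<^bsub>G\<^esub> \<notin> A \<and> (\<forall>a\<in>A. inv\<^bsub>G\<^esub> a \<in> A) \<and> generate G A = carrier G"

text \<open>The arc \<open>(g, a)\<close> is the directed edge from \<open>g\<close> to \<open>ga\<close> labeled \<open>a\<close>.\<close>

definition cayley_graph ::
    "('g, 'm) monoid_scheme \<Rightarrow> 'g set \<Rightarrow> ('g, 'g \<times> 'g) pre_digraph" where
  "cayley_graph G A =
    \<lparr> verts = carrier G, arcs = carrier G \<times> A, tail = fst, head = (\<lambda>(g, a). g \<otimes>\<^bsub>G\<^esub> a) \<rparr>"

definition reverse_edge :: "('g, 'm) monoid_scheme \<Rightarrow> 'g \<times> 'g \<Rightarrow> 'g \<times> 'g" where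
  "reverse_edge G = (\<lambda>(g, a). (g \<otimes>\<^bsub>G\<^esub> a, inv\<^bsub>G\<^esub> a))"

definition no_backtracking :: "('g, 'm) monoid_scheme \<Rightarrow> ('g \<times> 'g) awalk \<Rightarrow> bool" where
  "no_backtracking G p \<longleftrightarrow> (\<forall>i. Suc i < length p \<longrightarrow> p ! Suc i \<noteq> reverse_edge G (p ! i))"

text \<open>
  Undirected subgraphs of the Cayley graph are represented by subgraphs whose arc set is closed
  under edge reversal; an undirected edge lies in \<open>T\<close> iff either of its two directed edges is an arc
  of \<open>T\<close>. The library's \<^const>\<open>tree\<close> cannot be used for these, since it counts the closed
  walk along an edge and back as a cycle. Excluding backtracking removes exactly those cycles.
\<close>

definition undirected_tree :: "('g, 'm) monoid_scheme \<Rightarrow> ('g, 'g \<times> 'g) pre_digraph \<Rightarrow> bool" where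
  "undirected_tree G T \<longleftrightarrow>
    reverse_edge G ` arcs T \<subseteq> arcs T \<and>
    Digraph_Component.connected T \<and>
    \<not> (\<exists>p. pre_digraph.cycle T p \<and> no_backtracking G p)"

definition maximal_tree ::
    "('g, 'm) monoid_scheme \<Rightarrow> 'g set \<Rightarrow> ('g, 'g \<times> 'g) pre_digraph \<Rightarrow> bool" where
  "maximal_tree G A T \<longleftrightarrow> pre_digraph.max_subgraph (cayley_graph G A) (undirected_tree G) T"


section \<open>Flow functions and the stacking map\<close>

definition flow_less ::
    "('g, 'm) monoid_scheme \<Rightarrow> 'g set \<Rightarrow> ('g, 'g \<times> 'g) pre_digraph \<Rightarrow>
      ('g \<times> 'g \<Rightarrow> ('g \<times> 'g) awalk) \<Rightarrow> (('g \<times> 'g) \<times> ('g \<times> 'g)) set" where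
  "flow_less G A T \<Phi> =
    {(e', e). e \<in> arcs (cayley_graph G A) \<and> e' \<in> set (\<Phi> e) \<and> e \<notin> arcs T \<and> e' \<notin> arcs T}"

definition flow_function ::
    "('g, 'm) monoid_scheme \<Rightarrow> 'g set \<Rightarrow> ('g, 'g \<times> 'g) pre_digraph \<Rightarrow>
      ('g \<times> 'g \<Rightarrow> ('g \<times> 'g) awalk) \<Rightarrow> bool" where
  "flow_function G A T \<Phi> \<longleftrightarrow>
    maximal_tree G A T \<and>
    (\<forall>e \<in> arcs (cayley_graph G A).
      pre_digraph.awalk (cayley_graph G A)
        (tail (cayley_graph G A) e) (\<Phi> e) (head (cayley_graph G A) e)) \<and>
    (\<forall>e \<in> arcs T. \<Phi> e = [e]) \<and>
    trans ((flow_less G A T \<Phi>)\<^sup>+) \<and> irrefl ((flow_less G A T \<Phi>)\<^sup>+) \<and> wf ((flow_less G A T \<Phi>)\<^sup>+)"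

definition bounded_flow ::
    "('g, 'm) monoid_scheme \<Rightarrow> 'g set \<Rightarrow> ('g \<times> 'g \<Rightarrow> ('g \<times> 'g) awalk) \<Rightarrow> bool" where
  "bounded_flow G A \<Phi> \<longleftrightarrow> (\<exists>k::nat. \<forall>e \<in> arcs (cayley_graph G A). length (\<Phi> e) \<le> k)"

definition path_label :: "('g \<times> 'g) awalk \<Rightarrow> 'g list" where
  "path_label p = map snd p"

definition tree_word ::
    "('g, 'm) monoid_scheme \<Rightarrow> ('g, 'g \<times> 'g) pre_digraph \<Rightarrow> 'g \<Rightarrow> 'g list" where
  "tree_word G T g =
    path_label (THE p. pre_digraph.awalk T \<one>\<^bsub>G\<^esub> p g \<and> no_backtracking G p)"

text \<open>
  Elements of \<open>(A\<^sup>*)\<^sup>n\<close> are lists of \<open>n\<close> words. Since \<open>y\<^sub>g\<close> determines \<open>g\<close>, the value of the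
  stacking map at \<open>(y\<^sub>g, a)\<close> is written directly as the label of the path assigned to \<open>(g, a)\<close>.
\<close>

definition stacking_graph ::
    "('g, 'm) monoid_scheme \<Rightarrow> 'g set \<Rightarrow> ('g, 'g \<times> 'g) pre_digraph \<Rightarrow>
      ('g \<times> 'g \<Rightarrow> ('g \<times> 'g) awalk) \<Rightarrow> 'g list list set" where
  "stacking_graph G A T \<Phi> =
    {[tree_word G T g, [a], path_label (\<Phi> (g, a))] | g a. g \<in> carrier G \<and> a \<in> A}"


section \<open>Synchronously regular languages\<close>

text \<open>Recognition by a deterministic finite automaton with state set \<open>Q\<close>.\<close>

definition regular_language :: "'a set \<Rightarrow> 'a list set \<Rightarrow> bool" where
  "regular_language \<Sigma> L \<longleftrightarrow>
    (\<exists>(Q :: nat set) q0 (\<delta> :: nat \<Rightarrow> 'a \<Rightarrow> nat) F.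
      finite Q \<and> q0 \<in> Q \<and> F \<subseteq> Q \<and> (\<forall>q\<in>Q. \<forall>x\<in>\<Sigma>. \<delta> q x \<in> Q) \<and>
      L = {w \<in> lists \<Sigma>. foldl \<delta> q0 w \<in> F})"

text \<open>The padding symbol \<open>$\<close> is \<^const>\<open>None\<close>; \<open>n\<close>-tuples are lists of length \<open>n\<close>.\<close>

definition padded_alphabet :: "nat \<Rightarrow> 'a set \<Rightarrow> 'a option list set" where
  "padded_alphabet n A =
    {x. length x = n \<and> set x \<subseteq> insert None (Some ` A)} - {replicate n None}"

definition pad_tuple :: "'a list list \<Rightarrow> 'a option list list" where
  "pad_tuple us =
    map (\<lambda>m. map (\<lambda>u. if m < length u then Some (u ! m) else None) us)
      [0..<Max (length ` set us)]"

definition synchronously_regular :: "nat \<Rightarrow> 'a set \<Rightarrow> 'a list list set \<Rightarrow> bool" where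
  "synchronously_regular n A L \<longleftrightarrow>
    (\<forall>us\<in>L. length us = n \<and> set us \<subseteq> lists A) \<and>
    regular_language (padded_alphabet n A) (pad_tuple ` L)"


section \<open>Autostackable groups\<close>

definition autostackable_over :: "('g, 'm) monoid_scheme \<Rightarrow> 'g set \<Rightarrow> bool" where
  "autostackable_over G A \<longleftrightarrow>
    (\<exists>T \<Phi>. flow_function G A T \<Phi> \<and> bounded_flow G A \<Phi> \<and>
      synchronously_regular 3 A (stacking_graph G A T \<Phi>))"

definition autostackable :: "('g, 'm) monoid_scheme \<Rightarrow> bool" where
  "autostackable G \<longleftrightarrow> (\<exists>A. inverse_closed_generating_set G A \<and> autostackable_over G A)"

end

theory Submission
  imports Defs "HOL-Library.Sublist"
begin

text \<open>
  \<^bold>\<open>Normal forms.\<close> The four generators \<open>a, b, c, d\<close> generate \<open>F(a,b) \<times> F(c,d)\<close>. Let \<open>N\<close> be the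
  kernel of the map from this product to the integers that sends every generator to \<open>1\<close>. The
  relators that involve \<open>s\<close> say exactly that \<open>s\<close> centralizes \<open>N\<close>, so Stallings' group is the HNN
  extension of \<open>F(a,b) \<times> F(c,d)\<close> with associated subgroup \<open>N\<close> and the identity as identification.
  As the powers of \<open>a\<close> represent the cosets of \<open>N\<close>, every element is \<open>u v w\<close> for unique freely
  reduced words \<open>u\<close> in \<open>a, b\<close>, \<open>v\<close> in \<open>c, d\<close>, and \<open>w\<close> in \<open>a, s\<close>, where \<open>w\<close> is empty or begins with
  \<open>s\<close> or \<open>s\<^sup>-\<^sup>1\<close>. These words form a prefix-closed regular language, so they span a maximal tree of
  the Cayley graph.

  \<^bold>\<open>The flow.\<close> Because \<open>N\<close> is normal and every generator except \<open>s\<close> lies in the coset \<open>N a\<close>, right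
  multiplication by \<open>b\<close>, \<open>c\<close> or \<open>d\<close> changes a nonempty \<open>w\<close> exactly as \<open>a\<close> does. An edge outside
  the tree with label \<open>x\<close> is replaced by a path as follows, where \<open>l\<close> is the last letter of the
  normal form and \<open>x\<close> is \<open>z\<close> or \<open>z\<^sup>-\<^sup>1\<close> for the generator \<open>z\<close>.
  \<^item> If \<open>w\<close> is empty, \<open>l\<close> is a letter of \<open>v\<close> and \<open>z\<close> is \<open>a\<close> or \<open>b\<close>, then \<open>x = l\<^sup>-\<^sup>1 x l\<close>.
  \<^item> If \<open>l\<close> is \<open>s\<close> or its inverse and \<open>z\<close> is \<open>b\<close>, \<open>c\<close> or \<open>d\<close>, then \<open>l\<close> commutes with the element
    \<open>x a\<^sup>\<mp>\<^sup>1\<close> of \<open>N\<close>, hence \<open>x = l\<^sup>-\<^sup>1 x a\<^sup>\<mp>\<^sup>1 l a\<^sup>\<plusminus>\<^sup>1\<close>.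
  \<^item> If \<open>w\<close> is nonempty, \<open>l\<close> is \<open>a\<close> or its inverse and \<open>z\<close> is \<open>c\<close> or \<open>d\<close>, then \<open>x = l\<^sup>-\<^sup>1 x l\<close>.
  \<^item> If \<open>w\<close> is nonempty, \<open>l = a\<^sup>\<plusminus>\<^sup>1\<close> and \<open>z = b\<close>, then \<open>l\<close> does not commute with \<open>x\<close>, but \<open>c\<close> does,
    and multiplication by \<open>c\<^sup>\<mp>\<^sup>1\<close> also removes \<open>l\<close> from \<open>w\<close>: take \<open>x = c\<^sup>\<mp>\<^sup>1 x c\<^sup>\<plusminus>\<^sup>1\<close>.

  In each path every edge lies in the tree or is simpler than the edge it replaces: edges with
  empty \<open>w\<close> come first and are ordered by the length of \<open>v\<close>; the others are ordered by the length
  of \<open>w\<close>, and for equal length edges labeled \<open>b\<close> come after those labeled \<open>c, d\<close>. The path depends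
  only on \<open>x\<close>, on \<open>l\<close> and on whether \<open>w\<close> is empty, all of which a finite automaton reading the
  normal form can remember, so the graph of the stacking map is synchronously regular.

  \<^bold>\<open>What has to be proved about the group.\<close> The flow itself shows that normal forms exist: an edge
  is followed by following its path, whose edges are tree edges or simpler (lemma
  \<open>step_normalizes\<close>). They are unique because three functions on words respect the presentation
  (\<open>fold_act_u_eq\<close>, \<open>fold_act_v_eq\<close>, \<open>fold_act_w_eq\<close>): the free reductions of the part in \<open>a, b\<close>
  and of the part in \<open>c, d\<close>, and the action of the group on the right cosets of \<open>F(a,b) \<times> F(c,d)\<close>,
  of which the words \<open>w\<close> are representatives. The lengths of \<open>v\<close> and \<open>w\<close> along a path are read off
  from the same functions.

  The general part of the argument is \<open>autostackable_over_if_flow\<close>, from normal forms in a group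
  to its Cayley graph, and \<open>autostackable_presentation\<close>, from words to the presented group.
\<close>

section \<open>Spanning trees from normal forms\<close>

primrec labelled_path :: "('g, 'm) monoid_scheme \<Rightarrow> 'g \<Rightarrow> 'g list \<Rightarrow> ('g \<times> 'g) awalk" where
  "labelled_path G g [] = []"
| "labelled_path G g (a # y) = (g, a) # labelled_path G (g \<otimes>\<^bsub>G\<^esub> a) y"

lemma path_label_labelled_path [simp]: "path_label (labelled_path G g y) = y"
  by (induction y arbitrary: g) (simp_all add: path_label_def)

lemma length_labelled_path [simp]: "length (labelled_path G g y) = length y"
  by (induction y arbitrary: g) simp_all

lemma in_set_labelled_path:
  "e \<in> set (labelled_path G g y) \<longleftrightarrow>
    (\<exists>p b q. y = p @ b # q \<and> e = (foldl (\<otimes>\<^bsub>G\<^esub>) g p, b))"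
proof (induction y arbitrary: g)
  case (Cons a y)
  show ?case (is "?l \<longleftrightarrow> ?r")
  proof
    assume ?l
    then consider "e = (g, a)" | "e \<in> set (labelled_path G (g \<otimes>\<^bsub>G\<^esub> a) y)" by auto
    then show ?r
    proof cases
      case 1
      then show ?thesis by (intro exI[of _ "[]"] exI) auto
    next
      case 2
      then obtain p b q where "y = p @ b # q" "e = (foldl (\<otimes>\<^bsub>G\<^esub>) (g \<otimes>\<^bsub>G\<^esub> a) p, b)"
        using Cons by auto
      then show ?thesis by (intro exI[of _ "a # p"] exI) auto
    qed
  next
    assume ?r
    then obtain p b q where r: "a # y = p @ b # q" "e = (foldl (\<otimes>\<^bsub>G\<^esub>) g p, b)" by blast
    then show ?l
    proof (cases p)
      case Nil
      then show ?thesis using r by simp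
    next
      case p: (Cons c p')
      then have "y = p' @ b # q" "e = (foldl (\<otimes>\<^bsub>G\<^esub>) (g \<otimes>\<^bsub>G\<^esub> a) p', b)" using r by auto
      then show ?thesis using Cons.IH by auto
    qed
  qed
qed simp

lemma no_backtracking_Cons:
  "no_backtracking G (e # f # p) \<longleftrightarrow> f \<noteq> reverse_edge G e \<and> no_backtracking G (f # p)"
  unfolding no_backtracking_def by (simp add: All_less_Suc2 nth_Cons split: nat.splits)

lemma no_backtracking_tl: "no_backtracking G (e # p) \<Longrightarrow> no_backtracking G p"
  unfolding no_backtracking_def by force

lemma no_backtracking_butlast: "no_backtracking G (p @ [e]) \<Longrightarrow> no_backtracking G p"
  unfolding no_backtracking_def
  by (metis Suc_lessD butlast_snoc length_append_singleton less_SucI nth_butlast)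

lemma (in group) foldl_mult_closed:
  "\<lbrakk>g \<in> carrier G; set y \<subseteq> carrier G\<rbrakk> \<Longrightarrow> foldl (\<otimes>) g y \<in> carrier G"
  by (induction y arbitrary: g) auto

text \<open>The last hypothesis makes the set of normal forms closed under prefixes, so that deleting
  the last letter of its normal form defines a parent for every element except the identity. The
  tree \<open>T\<close> below joins each element to its parent.\<close>

locale normal_form_tree = group G for G (structure) +
  fixes A :: "'a set" and nf :: "'a \<Rightarrow> 'a list"
  assumes gens: "inverse_closed_generating_set G A"
    and nf_letters: "g \<in> carrier G \<Longrightarrow> set (nf g) \<subseteq> A"
    and nf_value: "g \<in> carrier G \<Longrightarrow> foldl (\<otimes>) \<one> (nf g) = g"
    and nf_prefix: "\<lbrakk>g \<in> carrier G; nf g = y @ [a]\<rbrakk> \<Longrightarrow> nf (foldl (\<otimes>) \<one> y) = y"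
begin

lemma gen_carrier [simp]: "a \<in> A \<Longrightarrow> a \<in> carrier G"
  and inv_gen [simp]: "a \<in> A \<Longrightarrow> inv a \<in> A"
  using gens unfolding inverse_closed_generating_set_def by auto

text \<open>Deleting letters from any normal form ends with the empty word.\<close>

lemma nf_one [simp]: "nf \<one> = []"
proof -
  have "g \<in> carrier G \<Longrightarrow> nf g = y \<Longrightarrow> nf \<one> = []" for g y
  proof (induction y arbitrary: g rule: rev_induct)
    case Nil
    then show ?case using nf_value[of g] by simp
  next
    case (snoc a y)
    have "set y \<subseteq> carrier G" using snoc.prems nf_letters[of g] gen_carrier by auto
    then show ?case using snoc.IH[of "foldl (\<otimes>) \<one> y"] nf_prefix snoc.prems foldl_mult_closed by blast
  qed
  then show ?thesis by blast
qed

text \<open>A walk that starts at the identity and follows only these directed edges spells out the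
  normal form of its end point.\<close>

definition up_edges :: "('a \<times> 'a) set" where
  "up_edges = {(g, a). g \<in> carrier G \<and> a \<in> A \<and> nf (g \<otimes> a) = nf g @ [a]}"

definition T :: "('a, 'a \<times> 'a) pre_digraph" where
  "T = \<lparr> verts = carrier G,
     arcs = {(g, a). g \<in> carrier G \<and> a \<in> A \<and>
       (nf (g \<otimes> a) = nf g @ [a] \<or> nf g = nf (g \<otimes> a) @ [inv a])},
     tail = fst, head = (\<lambda>(g, a). g \<otimes> a) \<rparr>"

lemma verts_T [simp]: "verts T = carrier G"
  and tail_T [simp]: "tail T = fst"
  and head_T [simp]: "head T (g, a) = g \<otimes> a"
  and head_T': "head T = (\<lambda>(g, a). g \<otimes> a)"
  by (simp_all add: T_def)

lemma arcs_T:
  "(g, a) \<in> arcs T \<longleftrightarrow> g \<in> carrier G \<and> a \<in> A \<and>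
    (nf (g \<otimes> a) = nf g @ [a] \<or> nf g = nf (g \<otimes> a) @ [inv a])"
  by (simp add: T_def)

lemma mult_inv_gen [simp]: "\<lbrakk>g \<in> carrier G; a \<in> A\<rbrakk> \<Longrightarrow> g \<otimes> a \<otimes> inv a = g"
  using inv_solve_right' by auto

lemma up_edges_subset: "up_edges \<subseteq> arcs T"
  by (auto simp: up_edges_def arcs_T)

lemma reverse_edge_T: "e \<in> arcs T \<Longrightarrow> reverse_edge G e \<in> arcs T"
  by (cases e) (auto simp: reverse_edge_def arcs_T)

lemma down_edge:
  "\<lbrakk>(g, a) \<in> arcs T; (g, a) \<notin> up_edges\<rbrakk> \<Longrightarrow> nf g = nf (g \<otimes> a) @ [inv a]"
  by (auto simp: up_edges_def arcs_T)

interpretation cayley: wf_digraph "cayley_graph G A"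
  by unfold_locales (auto simp: cayley_graph_def)

interpretation T: wf_digraph T
  by unfold_locales (auto simp: T_def)

lemma subgraph_T: "subgraph T (cayley_graph G A)"
  by (intro subgraphI cayley.wf_digraph_axioms T.wf_digraph_axioms)
    (auto simp: cayley_graph_def T_def compatible_def)

text \<open>An ascent cannot turn into a descent: the only edge of the tree that leads from \<open>g\<close> towards
  the identity undoes the last letter of the normal form of \<open>g\<close>.\<close>

lemma up_edge_step:
  assumes "(g, a) \<in> up_edges" "(g \<otimes> a, b) \<in> arcs T" "(g \<otimes> a, b) \<noteq> reverse_edge G (g, a)"
  shows "(g \<otimes> a, b) \<in> up_edges"
proof (rule ccontr)
  assume "(g \<otimes> a, b) \<notin> up_edges"
  then have "nf (g \<otimes> a) = nf (g \<otimes> a \<otimes> b) @ [inv b]" using assms down_edge by blast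
  moreover have "nf (g \<otimes> a) = nf g @ [a]" "b \<in> A" using assms by (auto simp: up_edges_def arcs_T)
  ultimately have "b = inv a" using inv_inv gen_carrier by fastforce
  then show False using assms by (simp add: reverse_edge_def)
qed

lemma ascending_walk:
  assumes "T.awalk u p v" "no_backtracking G p" "p \<noteq> []" "hd p \<in> up_edges"
  shows "nf v = nf u @ path_label p" and "last p \<in> up_edges"
proof -
  have "nf v = nf u @ path_label p \<and> last p \<in> up_edges"
    using assms
  proof (induction p arbitrary: u)
    case (Cons e p)
    obtain g a where e: "e = (g, a)" by fastforce
    have u: "g = u" and up: "(u, a) \<in> up_edges" and w: "T.awalk (u \<otimes> a) p v"
      using Cons.prems by (auto simp: e T.awalk_Cons_iff)
    have nf_ua: "nf (u \<otimes> a) = nf u @ [a]" using up by (auto simp: up_edges_def)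
    show ?case
    proof (cases p)
      case Nil
      then show ?thesis using nf_ua w up by (auto simp: e u path_label_def T.awalk_Nil_iff)
    next
      case (Cons f p')
      obtain b where "f = (u \<otimes> a, b)" and "f \<in> arcs T"
        using w by (cases f) (auto simp: Cons T.awalk_Cons_iff)
      then have "f \<in> up_edges"
        using up_edge_step[OF up] Cons.prems(2) by (auto simp: Cons e u no_backtracking_Cons)
      then show ?thesis
        using Cons.IH[OF w] Cons.prems(2) nf_ua
        by (auto simp: Cons e u path_label_def dest: no_backtracking_tl)
    qed
  qed simp
  then show "nf v = nf u @ path_label p" and "last p \<in> up_edges" by auto
qed

text \<open>A closed walk must descend first and ascend last, hence starts and ends with the same edge
  at its base point, traversed in opposite directions; the part between is a shorter closed walk.\<close>

lemma no_closed_walk: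
  assumes "T.awalk u p u" "no_backtracking G p" shows "p = []"
  using assms
proof (induction "length p" arbitrary: u p rule: less_induct)
  case less
  show ?case
  proof (rule ccontr)
    assume "p \<noteq> []"
    have first: "hd p \<notin> up_edges"
      using ascending_walk(1)[OF less.prems \<open>p \<noteq> []\<close>] \<open>p \<noteq> []\<close> by (auto simp: path_label_def)
    \<comment> \<open>Descents shorten the normal form, so a closed walk cannot consist of descents alone.\<close>
    have descending: "length (nf v) < length (nf w)"
      if "T.awalk w q v" "q \<noteq> []" "\<forall>e\<in>set q. e \<notin> up_edges" for w q v
      using that
    proof (induction q arbitrary: w)
      case (Cons e q)
      obtain a where e: "e = (w, a)" and "e \<in> arcs T" and w: "T.awalk (w \<otimes> a) q v"
        using Cons.prems by (cases e) (auto simp: T.awalk_Cons_iff)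
      then have "nf w = nf (w \<otimes> a) @ [inv a]" using down_edge Cons.prems by auto
      then show ?case
        using Cons.IH[OF w] Cons.prems w by (cases "q = []") (auto simp: T.awalk_Nil_iff)
    qed simp
    have last_up: "last q \<in> up_edges"
      if "T.awalk w q v" "no_backtracking G q" "\<exists>e\<in>set q. e \<in> up_edges" for w q v
      using that
    proof (induction q arbitrary: w)
      case (Cons e q)
      show ?case
      proof (cases "e \<in> up_edges")
        case True
        then show ?thesis using ascending_walk(2)[OF Cons.prems(1,2)] by simp
      next
        case False
        then have "q \<noteq> []" and "\<exists>f\<in>set q. f \<in> up_edges" using Cons.prems(3) by auto
        then show ?thesis
          using Cons.IH[of "head T e"] Cons.prems(1,2) no_backtracking_tl[of G e q]
          by (simp add: T.awalk_Cons_iff)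
      qed
    qed simp
    have last: "last p \<in> up_edges"
      using last_up[OF less.prems] descending[OF less.prems(1) \<open>p \<noteq> []\<close>] by blast
    obtain e p' where p: "p = e # p'" using \<open>p \<noteq> []\<close> by (cases p) auto
    then have "p' \<noteq> []" using first last by auto
    then obtain m f where p': "p' = m @ [f]" by (metis rev_exhaust)
    obtain a where e: "e = (u, a)" and "e \<in> arcs T" and walk: "T.awalk (u \<otimes> a) (m @ [f]) u"
      using less.prems by (cases e) (auto simp: p p' T.awalk_Cons_iff)
    have a: "a \<in> A" "u \<in> carrier G" using \<open>e \<in> arcs T\<close> by (auto simp: e arcs_T)
    obtain w b where f: "f = (w, b)" by fastforce
    have m: "T.awalk (u \<otimes> a) m w" and wb: "w \<otimes> b = u"
      using walk by (auto simp: f T.awalk_Cons_iff T.awalk_Nil_iff)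
    have "nf u = nf (u \<otimes> a) @ [inv a]" using down_edge first \<open>e \<in> arcs T\<close> by (simp add: p e)
    moreover have "nf u = nf w @ [b]" "w \<in> carrier G" "b \<in> A"
      using last wb by (auto simp: p p' f up_edges_def)
    ultimately have b: "b = inv a" "nf w = nf (u \<otimes> a)" by auto
    then have "w = u \<otimes> a" using nf_value a \<open>w \<in> carrier G\<close> by (metis gen_carrier m_closed)
    then have "T.awalk w m w" "f = reverse_edge G e" using m b by (auto simp: f e reverse_edge_def)
    moreover have "no_backtracking G m"
      using less.prems(2) by (auto simp: p p' dest: no_backtracking_tl no_backtracking_butlast)
    ultimately have "m = []" using less.hyps[of m w] by (simp add: p p')
    then show False using less.prems(2) \<open>f = reverse_edge G e\<close> by (simp add: p p' no_backtracking_Cons)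
  qed
qed

text \<open>The path grows with the normal form, edge by edge. A new ascending edge cannot backtrack,
  since its reverse descends.\<close>

lemma nf_path:
  assumes "g \<in> carrier G"
  shows "\<exists>p. T.awalk \<one> p g \<and> no_backtracking G p"
proof -
  have "\<exists>p. T.awalk \<one> p g \<and> no_backtracking G p \<and> (p \<noteq> [] \<longrightarrow> hd p \<in> up_edges)" if "nf g = y" for y
    using assms that
  proof (induction y arbitrary: g rule: rev_induct)
    case Nil
    then have "T.awalk \<one> [] g" using nf_value[of g] by (simp add: T.awalk_Nil_iff)
    then show ?case by (intro exI[of _ "[]"]) (simp add: no_backtracking_def)
  next
    case (snoc a y)
    define h where "h = foldl (\<otimes>) \<one> y"
    have a: "a \<in> A" "set y \<subseteq> A" using nf_letters[of g] snoc.prems by auto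
    have h: "h \<in> carrier G" unfolding h_def using a by (intro foldl_mult_closed) auto
    have nf_h: "nf h = y" using nf_prefix snoc.prems by (simp add: h_def)
    have g: "h \<otimes> a = g" using nf_value[of g] snoc.prems by (simp add: h_def)
    have up: "(h, a) \<in> up_edges" using snoc.prems a h nf_h g by (simp add: up_edges_def)
    obtain p where p: "T.awalk \<one> p h" "no_backtracking G p" "p \<noteq> [] \<longrightarrow> hd p \<in> up_edges"
      using snoc.IH[OF h nf_h] by blast
    have "T.awalk \<one> (p @ [(h, a)]) g"
      using p(1) up up_edges_subset g h a by (auto simp: T.awalk_Cons_iff T.awalk_Nil_iff)
    moreover have "no_backtracking G (p @ [(h, a)])"
      unfolding no_backtracking_def
    proof (intro allI impI)
      fix i assume i: "Suc i < length (p @ [(h, a)])"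
      show "(p @ [(h, a)]) ! Suc i \<noteq> reverse_edge G ((p @ [(h, a)]) ! i)"
      proof (cases "Suc i < length p")
        case True
        then show ?thesis using p(2) by (simp add: no_backtracking_def nth_append)
      next
        case False
        then have il: "Suc i = length p" "p \<noteq> []" using i by auto
        have "last p \<in> up_edges" using ascending_walk(2)[OF p(1,2)] p(3) il by simp
        obtain k b where kb: "last p = (k, b)" by fastforce
        have "T.awalk \<one> (butlast p @ [(k, b)]) h" using p(1) il kb by (metis append_butlast_last_id)
        then have "k \<otimes> b = h" by (auto simp: T.awalk_Cons_iff T.awalk_Nil_iff)
        have "reverse_edge G (k, b) \<noteq> (h, a)"
        proof
          assume "reverse_edge G (k, b) = (h, a)"
          then have "h = k \<otimes> b" "a = inv b" by (auto simp: reverse_edge_def)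
          then have "h \<otimes> a = k" using \<open>last p \<in> up_edges\<close> kb by (auto simp: up_edges_def)
          then have "nf k = nf k @ [b] @ [a]"
            using up \<open>last p \<in> up_edges\<close> kb \<open>k \<otimes> b = h\<close> by (auto simp: up_edges_def)
          then show False by simp
        qed
        then show ?thesis using il kb by (auto simp: nth_append last_conv_nth simp flip: il(1))
      qed
    qed
    moreover have "hd (p @ [(h, a)]) \<in> up_edges" using p(3) up by (cases p) auto
    ultimately show ?case by blast
  qed
  then show ?thesis by blast
qed

text \<open>No edge of the tree at the identity descends, so a walk without backtracking ascends all the
  way.\<close>

lemma path_label_from_one:
  assumes "T.awalk \<one> p g" "no_backtracking G p"
  shows "path_label p = nf g"
proof (cases p)
  case Nil
  then show ?thesis using assms(1) by (auto simp: path_label_def T.awalk_Nil_iff)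
next
  case (Cons e p')
  have "e \<in> arcs T" "fst e = \<one>" using assms(1) by (auto simp: Cons T.awalk_Cons_iff)
  then have "hd p \<in> up_edges" using down_edge by (cases e) (fastforce simp: Cons)
  then show ?thesis using ascending_walk(1)[OF assms] Cons by simp
qed

lemma awalk_determined_by_label:
  "\<lbrakk>T.awalk u p v; T.awalk u q w; path_label p = path_label q\<rbrakk> \<Longrightarrow> p = q"
proof (induction p arbitrary: u q)
  case Nil
  then show ?case by (simp add: path_label_def)
next
  case (Cons e p)
  then obtain f q' where q: "q = f # q'" by (cases q) (auto simp: path_label_def)
  have "e = f" using Cons.prems by (cases e; cases f) (auto simp: q path_label_def T.awalk_Cons_iff)
  then show ?case using Cons.prems Cons.IH by (auto simp: q path_label_def T.awalk_Cons_iff)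
qed

lemma tree_word_T: "g \<in> carrier G \<Longrightarrow> tree_word G T g = nf g"
proof -
  assume "g \<in> carrier G"
  then obtain p where p: "T.awalk \<one> p g \<and> no_backtracking G p" using nf_path by blast
  then have "(THE p. T.awalk \<one> p g \<and> no_backtracking G p) = p"
    using path_label_from_one awalk_determined_by_label by (intro the_equality) metis+
  then show "tree_word G T g = nf g" using path_label_from_one p by (simp add: tree_word_def)
qed

lemma symmetric_T: "symmetric T"
  unfolding symmetric_def
proof (rule symI)
  fix u v assume "(u, v) \<in> arcs_ends T"
  then obtain g a where "(g, a) \<in> arcs T" "u = g" "v = g \<otimes> a" by (auto simp: arcs_ends_conv)
  then have "(v, inv a) \<in> arcs T" "head T (v, inv a) = u"
    using reverse_edge_T[of "(g, a)"] by (auto simp: reverse_edge_def arcs_T)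
  then show "(v, u) \<in> arcs_ends T" by (force simp: arcs_ends_conv image_iff)
qed

lemma reachable_T: "\<lbrakk>u \<in> carrier G; v \<in> carrier G\<rbrakk> \<Longrightarrow> u \<rightarrow>\<^sup>*\<^bsub>T\<^esub> v"
  using nf_path T.reachable_awalkI symmetric_T symmetric_reachable T.wf_digraph_axioms
    T.reachable_trans by metis

lemma undirected_tree_T: "undirected_tree G T"
  unfolding undirected_tree_def
proof (intro conjI)
  show "reverse_edge G ` arcs T \<subseteq> arcs T" using reverse_edge_T by blast
  have "strongly_connected (with_proj (mk_symmetric T))"
    unfolding strongly_connected_def
    using reachable_T T.reachable_mk_symmetricI by auto
  then show "Digraph_Component.connected T" unfolding connected_def .
  show "\<nexists>p. T.cycle p \<and> no_backtracking G p"
    using no_closed_walk unfolding T.cycle_def by blast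
qed

text \<open>Adding an edge \<open>e\<close> to the tree creates the cycle that consists of \<open>e\<close> and a path in the tree
  with distinct vertices from the end of \<open>e\<close> back to its start.\<close>

lemma maximal_tree_T: "maximal_tree G A T"
  unfolding maximal_tree_def cayley.max_subgraph_def
proof (safe intro!: subgraph_T undirected_tree_T)
  fix H assume H: "H \<noteq> T" "subgraph T H"
    and HC: "subgraph H (cayley_graph G A)" and HT: "undirected_tree G H"
  interpret H: wf_digraph H using HC by (simp add: subgraph_def)
  have TH: "subgraph T H" using H by simp
  have tail_H: "tail H = fst" and head_H: "head H = (\<lambda>(g, a). g \<otimes> a)" and verts_H: "verts H = carrier G"
    and arcs_H: "arcs H \<subseteq> carrier G \<times> A" and TH': "arcs T \<subseteq> arcs H"
    using TH HC unfolding subgraph_def by (auto simp: compatible_def T_def cayley_graph_def)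
  have "arcs H \<noteq> arcs T"
  proof
    assume "arcs H = arcs T"
    then have "H = T" by (intro pre_digraph.equality) (simp_all add: tail_H head_H verts_H head_T')
    then show False using H by simp
  qed
  then obtain g a where e: "(g, a) \<in> arcs H" "(g, a) \<notin> arcs T" using TH' by auto
  have ga: "g \<in> carrier G" "a \<in> A" using e arcs_H by auto
  obtain p where p: "T.apath (g \<otimes> a) p g"
    using reachable_T[of "g \<otimes> a" g] ga T.reachable_apath by auto
  have awalk_p: "T.awalk (g \<otimes> a) p g" and dist: "distinct (T.awalk_verts (g \<otimes> a) p)"
    using p by (auto simp: T.apath_def)
  have Hp: "H.awalk (g \<otimes> a) p g"
    using awalk_p TH TH' compatible_cas[of H T]
    unfolding T.awalk_def H.awalk_def subgraph_def by (auto simp: verts_H)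
  have verts_p: "H.awalk_verts (g \<otimes> a) p = T.awalk_verts (g \<otimes> a) p"
    using TH compatible_awalk_verts[of H T] by (simp add: subgraph_def)
  have walk: "H.awalk g ((g, a) # p) g" using Hp e by (simp add: H.awalk_Cons_iff tail_H head_H)
  have "H.cycle ((g, a) # p)"
    unfolding H.cycle_def using walk dist verts_p by (intro exI[of _ g]) (simp add: head_H)
  moreover have "no_backtracking G ((g, a) # p)"
    unfolding no_backtracking_def
  proof (intro allI impI notI)
    fix i assume i: "Suc i < length ((g, a) # p)"
      and rev: "((g, a) # p) ! Suc i = reverse_edge G (((g, a) # p) ! i)"
    let ?vs = "T.awalk_verts (g \<otimes> a) p"
    have "p \<noteq> []" using i by auto
    have vs: "?vs = map fst p @ [g]"
      using awalk_p \<open>p \<noteq> []\<close> T.awlast_if_cas[of "g \<otimes> a" p g] by (simp add: T.awalk_verts_conv T.awalk_def)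
    show False
    proof (cases i)
      case 0
      \<comment> \<open>Backtracking along the new edge would use its reverse, which is an edge of the tree.\<close>
      then have p0: "p ! 0 = (g \<otimes> a, inv a)" using rev by (simp add: reverse_edge_def)
      then obtain p' where p': "p = (g \<otimes> a, inv a) # p'" using \<open>p \<noteq> []\<close> by (cases p) auto
      then have "(g \<otimes> a, inv a) \<in> arcs T" using awalk_p by (simp add: T.awalk_Cons_iff)
      then have "(g, a) \<in> arcs T"
        using reverse_edge_T[of "(g \<otimes> a, inv a)"] ga by (simp add: reverse_edge_def)
      then show False using e by simp
    next
      case (Suc j)
      \<comment> \<open>Backtracking inside the tree path would visit the start \<open>h\<close> of its \<open>j\<close>-th edge twice.\<close>
      then have j: "Suc j < length p" "p ! Suc j = reverse_edge G (p ! j)" using i rev by auto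
      obtain h b where hb: "p ! j = (h, b)" by fastforce
      have "(h, b) \<in> arcs T" using awalk_p j hb nth_mem[of j p] by (auto simp: T.awalk_def)
      obtain q q' where split: "p = q @ p ! Suc j # q'" and q': "q' = drop (Suc (Suc j)) p"
        using id_take_nth_drop[OF j(1)] by blast
      then have "T.awalk (T.awlast (g \<otimes> a) q) (p ! Suc j # q') g"
        using awalk_p T.awalk_append_iff[of "g \<otimes> a" q "p ! Suc j # q'" g] by simp
      then have "T.awalk (head T (p ! Suc j)) (drop (Suc (Suc j)) p) g"
        by (simp add: T.awalk_Cons_iff q')
      moreover have "head T (p ! Suc j) = h"
        using j hb \<open>(h, b) \<in> arcs T\<close> by (simp add: reverse_edge_def arcs_T)
      ultimately have "T.awalk h (drop (Suc (Suc j)) p) g" by simp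
      then have "h \<in> set (map fst (drop (Suc (Suc j)) p) @ [g])"
        by (cases "drop (Suc (Suc j)) p") (auto simp: T.awalk_Nil_iff T.awalk_Cons_iff)
      then have "h \<in> set (drop (Suc j) ?vs)"
        using set_drop_subset_set_drop[of "Suc j" "Suc (Suc j)" "map fst p"] j vs by (auto simp: drop_map)
      moreover have "h \<in> set (take (Suc j) ?vs)"
        using j hb vs by (force simp: take_Suc_conv_app_nth)
      ultimately show False using dist set_take_disj_set_drop_if_distinct[of ?vs "Suc j" "Suc j"] by auto
    qed
  qed
  ultimately show False using HT unfolding undirected_tree_def by blast
qed

subsection \<open>Flow functions towards the tree\<close>

lemma awalk_labelled_path:
  "\<lbrakk>g \<in> carrier G; set y \<subseteq> A\<rbrakk> \<Longrightarrow>
    cayley.awalk g (labelled_path G g y) (foldl (\<otimes>) g y)"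
proof (induction y arbitrary: g)
  case Nil
  then show ?case by (simp add: cayley.awalk_Nil_iff) (simp add: cayley_graph_def)
next
  case (Cons a y)
  then have "cayley.awalk (g \<otimes> a) (labelled_path G (g \<otimes> a) y) (foldl (\<otimes>) (g \<otimes> a) y)" by simp
  then show ?case using Cons.prems by (simp add: cayley.awalk_Cons_iff) (simp add: cayley_graph_def)
qed

text \<open>The ordering in the definition of a flow function relates an edge outside the tree only to
  the edges outside the tree on its path. It is contained in \<open>r\<close>, hence well-founded.\<close>

theorem autostackable_over_if_flow:
  fixes \<phi> :: "'a \<Rightarrow> 'a \<Rightarrow> 'a list"
  assumes \<phi>_letters: "\<And>g a. \<lbrakk>g \<in> carrier G; a \<in> A\<rbrakk> \<Longrightarrow> set (\<phi> g a) \<subseteq> A"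
    and \<phi>_value: "\<And>g a. \<lbrakk>g \<in> carrier G; a \<in> A\<rbrakk> \<Longrightarrow> foldl (\<otimes>) g (\<phi> g a) = g \<otimes> a"
    and \<phi>_tree: "\<And>g a. (g, a) \<in> arcs T \<Longrightarrow> \<phi> g a = [a]"
    and \<phi>_bounded: "\<And>g a. \<lbrakk>g \<in> carrier G; a \<in> A\<rbrakk> \<Longrightarrow> length (\<phi> g a) \<le> k"
    and wf: "wf r"
    and decreasing: "\<And>g a p b q. \<lbrakk>g \<in> carrier G; a \<in> A; (g, a) \<notin> arcs T; \<phi> g a = p @ b # q;
        (foldl (\<otimes>) g p, b) \<notin> arcs T\<rbrakk> \<Longrightarrow> ((foldl (\<otimes>) g p, b), (g, a)) \<in> r"
    and regular: "synchronously_regular 3 A {[nf g, [a], \<phi> g a] | g a. g \<in> carrier G \<and> a \<in> A}"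
  shows "autostackable_over G A"
proof -
  define \<Phi> where "\<Phi> = (\<lambda>(g, a). labelled_path G g (\<phi> g a))"
  have less: "flow_less G A T \<Phi> \<subseteq> r"
    unfolding flow_less_def
    using decreasing by (auto simp: \<Phi>_def in_set_labelled_path cayley_graph_def)
  then have wf_less: "wf (flow_less G A T \<Phi>)" using wf wf_subset by blast
  have "flow_function G A T \<Phi>"
    unfolding flow_function_def
  proof (intro conjI maximal_tree_T ballI)
    fix e assume "e \<in> arcs (cayley_graph G A)"
    then show "cayley.awalk (tail (cayley_graph G A) e) (\<Phi> e) (head (cayley_graph G A) e)"
      using awalk_labelled_path \<phi>_letters \<phi>_value
      by (cases e) (metis (mono_tags, lifting) \<Phi>_def case_prod_conv cayley_graph_def fst_conv
          mem_Sigma_iff pre_digraph.select_convs(2,3,4))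
  next
    fix e assume "e \<in> arcs T"
    then show "\<Phi> e = [e]" using \<phi>_tree by (cases e) (simp add: \<Phi>_def)
  next
    show "wf ((flow_less G A T \<Phi>)\<^sup>+)" using wf_less by (rule wf_trancl)
    then show "irrefl ((flow_less G A T \<Phi>)\<^sup>+)" by (simp add: irrefl_def)
  qed (rule trans_trancl)
  moreover have "bounded_flow G A \<Phi>"
    unfolding bounded_flow_def using \<phi>_bounded by (auto simp: \<Phi>_def cayley_graph_def)
  moreover have "stacking_graph G A T \<Phi> = {[nf g, [a], \<phi> g a] | g a. g \<in> carrier G \<and> a \<in> A}"
    unfolding stacking_graph_def
    by (intro Collect_cong ex_cong1) (auto simp: \<Phi>_def tree_word_T)
  ultimately show ?thesis unfolding autostackable_over_def using regular by metis
qed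

end

section \<open>Regular languages by finiteness of derivatives\<close>

definition derivative :: "'a \<Rightarrow> 'a list set \<Rightarrow> 'a list set" where
  "derivative x L = {w. x # w \<in> L}"

text \<open>A language with finitely many iterated derivatives is regular, since the derivatives can
  serve as the states of an automaton. Asking for a finite family that is closed under
  derivatives, instead of the set of all iterated derivatives itself, makes closure properties
  easy: a family for a compound language is assembled from families for its parts.\<close>

definition finite_derivatives :: "'a set \<Rightarrow> 'a list set \<Rightarrow> bool" where
  "finite_derivatives \<Sigma> L \<longleftrightarrow>
    (\<exists>\<F>. finite \<F> \<and> L \<in> \<F> \<and> (\<forall>K\<in>\<F>. K \<subseteq> lists \<Sigma> \<and> (\<forall>x\<in>\<Sigma>. derivative x K \<in> \<F>)))"

lemma finite_derivativesE:
  assumes "finite_derivatives \<Sigma> L"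
  obtains \<F> where "finite \<F>" "L \<in> \<F>" "\<And>K. K \<in> \<F> \<Longrightarrow> K \<subseteq> lists \<Sigma>"
    "\<And>K x. \<lbrakk>K \<in> \<F>; x \<in> \<Sigma>\<rbrakk> \<Longrightarrow> derivative x K \<in> \<F>"
proof -
  obtain \<F> where \<F>: "finite \<F> \<and> L \<in> \<F> \<and> (\<forall>K\<in>\<F>. K \<subseteq> lists \<Sigma> \<and> (\<forall>x\<in>\<Sigma>. derivative x K \<in> \<F>))"
    using assms unfolding finite_derivatives_def ..
  show thesis by (rule that[of \<F>]) (use \<F> in simp_all)
qed

lemma finite_derivativesI:
  assumes "finite \<F>" "L \<in> \<F>" "\<And>K. K \<in> \<F> \<Longrightarrow> K \<subseteq> lists \<Sigma>"
    "\<And>K x. \<lbrakk>K \<in> \<F>; x \<in> \<Sigma>\<rbrakk> \<Longrightarrow> derivative x K \<in> \<F>"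
  shows "finite_derivatives \<Sigma> L"
  unfolding finite_derivatives_def using assms by (intro exI[of _ \<F>]) simp

lemma finite_derivatives_lists: "finite_derivatives \<Sigma> L \<Longrightarrow> L \<subseteq> lists \<Sigma>"
  by (erule finite_derivativesE)

lemma regular_language_if_finite_derivatives:
  assumes "finite_derivatives \<Sigma> L"
  shows "regular_language \<Sigma> L"
proof -
  obtain \<F> where fin: "finite \<F>" and L: "L \<in> \<F>" and lists: "\<And>K. K \<in> \<F> \<Longrightarrow> K \<subseteq> lists \<Sigma>"
    and closed: "\<And>K x. \<lbrakk>K \<in> \<F>; x \<in> \<Sigma>\<rbrakk> \<Longrightarrow> derivative x K \<in> \<F>"
    using assms by (rule finite_derivativesE) blast
  obtain code :: "'a list set \<Rightarrow> nat" where inj: "inj_on code \<F>"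
    using finite_imp_inj_to_nat_seg[OF fin] by blast
  define \<delta> where "\<delta> q x = code (derivative x (the_inv_into \<F> code q))" for q x
  define acc where "acc = code ` {K \<in> \<F>. [] \<in> K}"
  have \<delta>: "\<delta> (code K) x = code (derivative x K)" if "K \<in> \<F>" for K x
    using that by (simp add: \<delta>_def the_inv_into_f_f[OF inj])
  have run: "foldl \<delta> (code K) w \<in> acc \<longleftrightarrow> w \<in> K" if "K \<in> \<F>" "w \<in> lists \<Sigma>" for K w
    using that
  proof (induction w arbitrary: K)
    case Nil
    then show ?case using inj by (auto simp: acc_def dest: inj_onD)
  next
    case (Cons x w)
    then show ?case using closed by (simp add: \<delta>) (simp add: derivative_def)
  qed
  have "L = {w \<in> lists \<Sigma>. foldl \<delta> (code L) w \<in> acc}" using run[OF L] lists[OF L] by blast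
  moreover have "\<forall>q\<in>code ` \<F>. \<forall>x\<in>\<Sigma>. \<delta> q x \<in> code ` \<F>" using closed by (auto simp: \<delta>)
  ultimately show ?thesis
    unfolding regular_language_def
    using fin L by (intro exI[of _ "code ` \<F>"] exI[of _ "code L"] exI[of _ \<delta>] exI[of _ acc])
      (auto simp: acc_def)
qed

lemma finite_derivatives_Un:
  assumes "finite_derivatives \<Sigma> L" "finite_derivatives \<Sigma> M"
  shows "finite_derivatives \<Sigma> (L \<union> M)"
proof -
  obtain \<F> where \<F>: "finite \<F>" "L \<in> \<F>" "\<And>K. K \<in> \<F> \<Longrightarrow> K \<subseteq> lists \<Sigma>"
    "\<And>K x. \<lbrakk>K \<in> \<F>; x \<in> \<Sigma>\<rbrakk> \<Longrightarrow> derivative x K \<in> \<F>"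
    using finite_derivativesE[OF assms(1)] by metis
  obtain \<H> where \<H>: "finite \<H>" "M \<in> \<H>" "\<And>K. K \<in> \<H> \<Longrightarrow> K \<subseteq> lists \<Sigma>"
    "\<And>K x. \<lbrakk>K \<in> \<H>; x \<in> \<Sigma>\<rbrakk> \<Longrightarrow> derivative x K \<in> \<H>"
    using finite_derivativesE[OF assms(2)] by metis
  have Un: "derivative x (K \<union> K') = derivative x K \<union> derivative x K'" for x :: 'a and K K'
    by (auto simp: derivative_def)
  show ?thesis
  proof (rule finite_derivativesI[of "(\<lambda>(K, K'). K \<union> K') ` (\<F> \<times> \<H>)"])
    fix K x assume K: "K \<in> (\<lambda>(K, K'). K \<union> K') ` (\<F> \<times> \<H>)" and "x \<in> \<Sigma>"
    then obtain K1 K2 where "K = K1 \<union> K2" "K1 \<in> \<F>" "K2 \<in> \<H>" by auto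
    then show "derivative x K \<in> (\<lambda>(K, K'). K \<union> K') ` (\<F> \<times> \<H>)"
      using \<F>(4) \<H>(4) \<open>x \<in> \<Sigma>\<close> by (intro image_eqI[of _ _ "(derivative x K1, derivative x K2)"])
        (simp_all add: Un)
  next
    show "L \<union> M \<in> (\<lambda>(K, K'). K \<union> K') ` (\<F> \<times> \<H>)"
      using \<F>(2) \<H>(2) by (intro image_eqI[of _ _ "(L, M)"]) simp_all
    fix K assume "K \<in> (\<lambda>(K, K'). K \<union> K') ` (\<F> \<times> \<H>)"
    then obtain K1 K2 where "K = K1 \<union> K2" "K1 \<in> \<F>" "K2 \<in> \<H>" by auto
    then show "K \<subseteq> lists \<Sigma>" using \<F>(3)[of K1] \<H>(3)[of K2] by simp
  qed (use \<F>(1) \<H>(1) in simp)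
qed

lemma finite_derivatives_empty: "finite_derivatives \<Sigma> {}"
  by (rule finite_derivativesI[of "{{}}"]) (simp_all add: derivative_def)

lemma finite_derivatives_UN:
  "\<lbrakk>finite J; \<And>j. j \<in> J \<Longrightarrow> finite_derivatives \<Sigma> (L j)\<rbrakk> \<Longrightarrow> finite_derivatives \<Sigma> (\<Union>j\<in>J. L j)"
  by (induction J rule: finite_induct) (auto intro: finite_derivatives_empty finite_derivatives_Un)

subsection \<open>Padded tuples with fixed later components\<close>

definition head_letter :: "'a list \<Rightarrow> 'a option" where
  "head_letter u = (case u of [] \<Rightarrow> None | a # _ \<Rightarrow> Some a)"

lemma head_letter_simps [simp]:
  "head_letter [] = None" "head_letter (a # u) = Some a"
  "head_letter u = None \<longleftrightarrow> u = []" "None = head_letter u \<longleftrightarrow> u = []"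
  by (auto simp: head_letter_def split: list.splits)

lemma head_letter_Some: "head_letter u = Some a \<longleftrightarrow> (\<exists>v. u = a # v)"
  by (auto simp: head_letter_def split: list.splits)

lemma pad_tuple_Nil: "\<lbrakk>us \<noteq> []; \<forall>u\<in>set us. u = []\<rbrakk> \<Longrightarrow> pad_tuple us = []"
proof -
  assume "us \<noteq> []" "\<forall>u\<in>set us. u = []"
  then have "length ` set us = {0}" by (cases us) auto
  then show ?thesis by (simp add: pad_tuple_def)
qed

lemma pad_tuple_Cons:
  assumes "u \<in> set us" "u \<noteq> []"
  shows "pad_tuple us = map head_letter us # pad_tuple (map tl us)"
proof -
  define M where "M = Max (length ` set us)"
  have "length u \<le> M" using assms by (simp add: M_def)
  then have "0 < M" using assms(2) by (cases u) auto
  have "Max ((\<lambda>n. n - 1) ` length ` set us) = M - 1"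
    unfolding M_def using assms(1) by (intro mono_Max_commute[symmetric]) (auto intro!: monoI)
  then have tl: "Max (length ` set (map tl us)) = M - 1" by (simp add: image_image)
  have "[0..<M] = 0 # map Suc [0..<M - 1]" using \<open>0 < M\<close> by (simp add: map_Suc_upt upt_conv_Cons)
  then show ?thesis
    unfolding pad_tuple_def tl M_def[symmetric]
    by (auto simp: head_letter_def nth_tl less_diff_conv split: list.splits)
qed

definition padded_triples :: "'a list set \<Rightarrow> 'a list \<Rightarrow> 'a list \<Rightarrow> 'a option list list set" where
  "padded_triples Y z p = (\<lambda>y. pad_tuple [y, z, p]) ` Y"

definition padded_derivative :: "'a option \<Rightarrow> 'a list set \<Rightarrow> 'a list set" where
  "padded_derivative x Y = {tl y | y. y \<in> Y \<and> head_letter y = x}"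

lemma derivative_padded_triples:
  assumes x: "x \<in> padded_alphabet 3 A"
  shows "derivative x (padded_triples Y z p) =
    (if x ! 1 = head_letter z \<and> x ! 2 = head_letter p
     then padded_triples (padded_derivative (x ! 0) Y) (tl z) (tl p) else {})"
proof -
  have "length x = 3" and ne: "x \<noteq> replicate 3 None" using x by (auto simp: padded_alphabet_def)
  then obtain x0 x1 x2 where x: "x = [x0, x1, x2]" by (auto simp: numeral_3_eq_3 length_Suc_conv)
  have some: "\<not> (x0 = None \<and> x1 = None \<and> x2 = None)" using ne by (auto simp: x numeral_3_eq_3)
  have "x # w = pad_tuple [y, z, p] \<longleftrightarrow>
      x0 = head_letter y \<and> x1 = head_letter z \<and> x2 = head_letter p \<and> w = pad_tuple [tl y, tl z, tl p]"
    for w y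
  proof (cases "y = [] \<and> z = [] \<and> p = []")
    case True
    then show ?thesis using some by (auto simp: pad_tuple_Nil)
  next
    case False
    then have "pad_tuple [y, z, p] = map head_letter [y, z, p] # pad_tuple (map tl [y, z, p])"
      by (metis list.set_intros pad_tuple_Cons)
    then show ?thesis by (auto simp: x)
  qed
  then show ?thesis
    unfolding derivative_def padded_triples_def padded_derivative_def
    by (auto simp: x image_iff)
qed

lemma padded_triples_subset:
  assumes "Y \<subseteq> lists A" "z \<in> lists A" "p \<in> lists A"
  shows "padded_triples Y z p \<subseteq> lists (padded_alphabet 3 A)"
proof -
  have "pad_tuple [y, z, p] \<in> lists (padded_alphabet 3 A)"
    if "y \<in> lists A" "z \<in> lists A" "p \<in> lists A" for y z p
    using that
  proof (induction "length y + length z + length p" arbitrary: y z p rule: less_induct)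
    case less
    show ?case
    proof (cases "y = [] \<and> z = [] \<and> p = []")
      case True
      then show ?thesis by (simp add: pad_tuple_Nil)
    next
      case False
      then have eq: "pad_tuple [y, z, p] = map head_letter [y, z, p] # pad_tuple (map tl [y, z, p])"
        by (metis list.set_intros pad_tuple_Cons)
      have "tl u \<in> lists A" if "u \<in> lists A" for u using that by (cases u) auto
      moreover have "length (tl y) + length (tl z) + length (tl p) < length y + length z + length p"
        using False by (cases y; cases z; cases p) auto
      ultimately have "pad_tuple [tl y, tl z, tl p] \<in> lists (padded_alphabet 3 A)"
        using less by blast
      moreover have "map head_letter [y, z, p] \<in> padded_alphabet 3 A"
        using False less.prems
        by (cases y; cases z; cases p) (auto simp: padded_alphabet_def numeral_3_eq_3)
      ultimately show ?thesis by (simp add: eq)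
    qed
  qed
  then show ?thesis
    unfolding padded_triples_def using assms by (intro image_subsetI) (simp only: subset_iff)
qed

text \<open>Reading one letter of a padded triple removes the first letters of all three components. The
  second and third components are fixed words, which have finitely many suffixes. The first
  component passes to a derivative of \<open>Y\<close>, or, once the padding symbol has been read, to a
  language that contains at most the empty word.\<close>

lemma finite_derivatives_padded_triples:
  assumes "finite_derivatives A Y" "z \<in> lists A" "p \<in> lists A"
  shows "finite_derivatives (padded_alphabet 3 A) (padded_triples Y z p)"
proof -
  obtain \<F> where \<F>: "finite \<F>" "Y \<in> \<F>" "\<And>K. K \<in> \<F> \<Longrightarrow> K \<subseteq> lists A"
    "\<And>K x. \<lbrakk>K \<in> \<F>; x \<in> A\<rbrakk> \<Longrightarrow> derivative x K \<in> \<F>"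
    using finite_derivativesE[OF assms(1)] by metis
  define \<H> where "\<H> = \<F> \<union> {{}, {[]}}"
  have \<H>_lists: "K \<subseteq> lists A" if "K \<in> \<H>" for K using that \<F>(3) by (auto simp: \<H>_def)
  have \<H>_closed: "padded_derivative x K \<in> \<H>" if "K \<in> \<H>" "x \<in> insert None (Some ` A)" for x K
  proof (cases x)
    case None
    then have "padded_derivative x K = (if [] \<in> K then {[]} else {})"
      by (auto simp: padded_derivative_def)
    then show ?thesis by (simp add: \<H>_def)
  next
    case (Some a)
    then have "padded_derivative x K = derivative a K"
      by (auto simp: padded_derivative_def derivative_def head_letter_Some intro!: exI)
    moreover have "derivative a {} = {}" "derivative a {[]} = {}" by (simp_all add: derivative_def)
    ultimately show ?thesis using that \<F>(4) Some by (auto simp: \<H>_def)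
  qed
  define \<G> where "\<G> = (\<lambda>(K, z', p'). padded_triples K z' p') ` (\<H> \<times> set (suffixes z) \<times> set (suffixes p))"
  have \<G>I: "padded_triples K z' p' \<in> \<G>" if "K \<in> \<H>" "suffix z' z" "suffix p' p" for K z' p'
    using that by (force simp: \<G>_def)
  have "finite \<G>" using \<F>(1) by (simp add: \<G>_def \<H>_def)
  moreover have "padded_triples Y z p \<in> \<G>" using \<F>(2) by (intro \<G>I) (auto simp: \<H>_def)
  moreover have "K \<subseteq> lists (padded_alphabet 3 A) \<and> (\<forall>x\<in>padded_alphabet 3 A. derivative x K \<in> \<G>)"
    if "K \<in> \<G>" for K
  proof -
    obtain Z z' p' where K: "K = padded_triples Z z' p'" and Z: "Z \<in> \<H>"
      and suf: "suffix z' z" "suffix p' p"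
      using \<open>K \<in> \<G>\<close> by (auto simp: \<G>_def)
    have "z' \<in> lists A" "p' \<in> lists A" using suf assms(2,3) by (auto simp: suffix_def)
    then have "K \<subseteq> lists (padded_alphabet 3 A)"
      using K padded_triples_subset \<H>_lists[OF Z] by blast
    moreover have "derivative x K \<in> \<G>" if x: "x \<in> padded_alphabet 3 A" for x
    proof -
      have "x ! 0 \<in> insert None (Some ` A)"
        by (rule subsetD[OF _ nth_mem]) (use x in \<open>simp_all add: padded_alphabet_def\<close>)
      then have "padded_triples (padded_derivative (x ! 0) Z) (tl z') (tl p') \<in> \<G>"
        using \<H>_closed Z suf by (meson \<G>I suffix_order.trans suffix_tl)
      moreover have "{} \<in> \<G>" using \<G>I[of "{}" z p] by (simp add: \<H>_def padded_triples_def)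
      ultimately show ?thesis by (simp add: K derivative_padded_triples[OF x])
    qed
    ultimately show ?thesis by blast
  qed
  ultimately show ?thesis by (intro finite_derivativesI[of \<G>]) blast+
qed

lemma synchronously_regular_triples:
  assumes "finite J" "\<And>j. j \<in> J \<Longrightarrow> finite_derivatives A (Y j)"
    and "\<And>j. j \<in> J \<Longrightarrow> z j \<in> lists A" "\<And>j. j \<in> J \<Longrightarrow> p j \<in> lists A"
  shows "synchronously_regular 3 A (\<Union>j\<in>J. {[y, z j, p j] | y. y \<in> Y j})"
  unfolding synchronously_regular_def
proof
  have "Y j \<subseteq> lists A" if "j \<in> J" for j
    using assms(2)[OF that] by (rule finite_derivatives_lists)
  then show "\<forall>us\<in>\<Union>j\<in>J. {[y, z j, p j] | y. y \<in> Y j}. length us = 3 \<and> set us \<subseteq> lists A"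
    using assms(3,4) by fastforce
  have "pad_tuple ` (\<Union>j\<in>J. {[y, z j, p j] | y. y \<in> Y j}) = (\<Union>j\<in>J. padded_triples (Y j) (z j) (p j))"
    by (auto simp: padded_triples_def)
  moreover have "finite_derivatives (padded_alphabet 3 A) (\<Union>j\<in>J. padded_triples (Y j) (z j) (p j))"
    using assms by (intro finite_derivatives_UN finite_derivatives_padded_triples) auto
  ultimately show "regular_language (padded_alphabet 3 A) (pad_tuple ` (\<Union>j\<in>J. {[y, z j, p j] | y. y \<in> Y j}))"
    by (simp add: regular_language_if_finite_derivatives)
qed

section \<open>Autostackable presentations\<close>

primrec run :: "('s \<Rightarrow> 'l \<Rightarrow> 's option) \<Rightarrow> 's \<Rightarrow> 'l list \<Rightarrow> 's option" where
  "run \<delta> q [] = Some q"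
| "run \<delta> q (x # w) = Option.bind (\<delta> q x) (\<lambda>q'. run \<delta> q' w)"

lemma run_append: "run \<delta> q (u @ v) = Option.bind (run \<delta> q u) (\<lambda>q'. run \<delta> q' v)"
  by (induction u arbitrary: q) (simp_all add: bind_eq_Some_conv split: Option.bind_split)

lemma finite_derivatives_run:
  fixes \<delta> :: "'s::finite \<Rightarrow> 'l \<Rightarrow> 's option"
  assumes "inj \<iota>"
  shows "finite_derivatives (range \<iota>) (map \<iota> ` {w. run \<delta> q w = Some q'})"
proof (rule finite_derivativesI[of "insert {} (range (\<lambda>p. map \<iota> ` {w. run \<delta> p w = Some q'}))"])
  fix K x
  assume K: "K \<in> insert {} (range (\<lambda>p. map \<iota> ` {w. run \<delta> p w = Some q'}))" and "x \<in> range \<iota>"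
  then obtain l where x: "x = \<iota> l" by blast
  show "derivative x K \<in> insert {} (range (\<lambda>p. map \<iota> ` {w. run \<delta> p w = Some q'}))"
  proof (cases "K = {}")
    case True
    then show ?thesis by (simp add: derivative_def)
  next
    case False
    then obtain p where p: "K = map \<iota> ` {w. run \<delta> p w = Some q'}" using K by blast
    have "derivative x K = (case \<delta> p l of None \<Rightarrow> {} | Some p' \<Rightarrow> map \<iota> ` {w. run \<delta> p' w = Some q'})"
      using assms by (force simp: p x derivative_def image_iff Cons_eq_map_conv inj_eq split: option.splits)
    then show ?thesis by (auto split: option.splits)
  qed
qed auto

text \<open>The data of a flow on a presentation in terms of words. The automaton \<open>\<delta>\<close> accepts the normal
  forms (its partiality makes their language prefix-closed), and \<open>path\<close> is the flow, which depends
  only on the state reached by the normal form of the starting vertex. The map \<open>val\<close> assigns to a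
  word an invariant of the group element it represents. It carries all the information that is
  needed to recognize tree edges and to compare edges in the well-founded relation \<open>r\<close>, so that no
  normal form of an intermediate vertex of a path has to be computed.\<close>

locale presentation_flow =
  fixes R :: "'x gword set"
    and \<delta> :: "'s::finite \<Rightarrow> 'x \<times> bool \<Rightarrow> 's option" and q0 :: 's
    and path :: "'s \<Rightarrow> 'x \<times> bool \<Rightarrow> 'x gword"
    and val :: "'x gword \<Rightarrow> 'i"
    and tree_edge :: "'i \<Rightarrow> 'x \<times> bool \<Rightarrow> bool"
    and r :: "(('i \<times> ('x \<times> bool)) \<times> ('i \<times> ('x \<times> bool))) set"
  assumes finite_gens: "finite (UNIV :: 'x set)"
    and letters_distinct: "pres_eq R [x] [x'] \<Longrightarrow> x = x'"
    and letters_nontrivial: "\<not> pres_eq R [x] []"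
    and nf_unique: "\<lbrakk>run \<delta> q0 y = Some q; run \<delta> q0 y' = Some q'; pres_eq R y y'\<rbrakk> \<Longrightarrow> y = y'"
    and val_eq: "pres_eq R u v \<Longrightarrow> val u = val v"
    and tree_edge_iff: "run \<delta> q0 y = Some q \<Longrightarrow>
      tree_edge (val y) x \<longleftrightarrow> \<delta> q x \<noteq> None \<or> (\<exists>z. y = z @ [flip_letter x])"
    and path_tree: "\<lbrakk>run \<delta> q0 y = Some q; tree_edge (val y) x\<rbrakk> \<Longrightarrow> path q x = [x]"
    and path_eq: "run \<delta> q0 y = Some q \<Longrightarrow> pres_eq R (path q x) [x]"
    and wf: "wf r"
    and path_decreasing: "\<lbrakk>run \<delta> q0 y = Some q; \<not> tree_edge (val y) x; path q x = p @ z # t;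
        \<not> tree_edge (val (y @ p)) z\<rbrakk> \<Longrightarrow> ((val (y @ p), z), (val y, x)) \<in> r"
begin

lemma cancel_last: "pres_eq R (z @ [flip_letter x] @ [x]) z"
  using pres_eq.cancel[of R z "flip_letter x" "[]"] by simp

lemma tree_step:
  assumes "run \<delta> q0 y = Some q" "tree_edge (val y) x"
  shows "\<exists>n q'. run \<delta> q0 n = Some q' \<and> pres_eq R (y @ [x]) n"
proof (cases "\<delta> q x")
  case None
  then obtain z where z: "y = z @ [flip_letter x]" using tree_edge_iff assms by blast
  obtain q' where "run \<delta> q0 z = Some q'" using assms(1) z by (auto simp: run_append bind_eq_Some_conv)
  moreover have "pres_eq R (y @ [x]) z" using cancel_last[of z x] by (simp add: z)
  ultimately show ?thesis by blast
next
  case (Some q')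
  then have "run \<delta> q0 (y @ [x]) = Some q'" using assms(1) by (simp add: run_append)
  then show ?thesis using pres_eq.refl by blast
qed

text \<open>By well-founded induction on the edge: the path assigned to an edge outside the tree is
  traversed one edge at a time, each being a tree edge or smaller, and at each vertex on the way
  the normal form is replaced by that of the next vertex.\<close>

lemma step_normalizes:
  assumes "run \<delta> q0 y = Some q"
  shows "\<exists>n q'. run \<delta> q0 n = Some q' \<and> pres_eq R (y @ [x]) n"
proof -
  have "\<forall>y q. run \<delta> q0 y = Some q \<longrightarrow> val y = fst e \<longrightarrow>
      (\<exists>n q'. run \<delta> q0 n = Some q' \<and> pres_eq R (y @ [snd e]) n)" for e
  proof (induction e rule: wf_induct_rule[OF wf])
    case (1 e)
    obtain i x where e: "e = (i, x)" by (cases e)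
    show ?case
    proof (intro allI impI)
      fix y q assume y: "run \<delta> q0 y = Some q" and i: "val y = fst e"
      show "\<exists>n q'. run \<delta> q0 n = Some q' \<and> pres_eq R (y @ [snd e]) n"
      proof (cases "tree_edge (val y) x")
        case True
        then show ?thesis using tree_step y by (simp add: e)
      next
        case False
        have prefix: "\<exists>n q'. run \<delta> q0 n = Some q' \<and> pres_eq R (y @ p) n" if "path q x = p @ t" for p t
          using that
        proof (induction p arbitrary: t rule: rev_induct)
          case Nil
          then show ?case using y pres_eq.refl by auto
        next
          case (snoc z p)
          then obtain n q' where n: "run \<delta> q0 n = Some q'" "pres_eq R (y @ p) n" by force
          have "\<exists>n' q''. run \<delta> q0 n' = Some q'' \<and> pres_eq R (n @ [z]) n'"
          proof (cases "tree_edge (val (y @ p)) z")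
            case True
            then show ?thesis using tree_step n val_eq by metis
          next
            case hard: False
            have "((val (y @ p), z), e) \<in> r"
              using path_decreasing[OF y False _ hard, of t] snoc.prems i by (simp add: e)
            then show ?thesis using 1 n val_eq by (metis fst_conv snd_conv)
          qed
          moreover have "pres_eq R (y @ p @ [z]) (n @ [z])"
            using pres_eq_append_right[OF n(2), of "[z]"] by simp
          ultimately show ?case using pres_eq.trans by blast
        qed
        have "pres_eq R (y @ [x]) (y @ path q x)"
          using path_eq[OF y] by (simp add: pres_eq_append_left pres_eq.sym)
        then show ?thesis using prefix[of "path q x" "[]"] pres_eq.trans by (fastforce simp: e)
      qed
    qed
  qed
  from this[of "(val y, x)"] show ?thesis using assms by simp
qed

lemma nf_exists: "\<exists>n q. run \<delta> q0 n = Some q \<and> pres_eq R w n"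
proof (induction w rule: rev_induct)
  case Nil
  show ?case by (intro exI[of _ "[]"] exI[of _ q0]) (simp add: pres_eq.refl)
next
  case (snoc x w)
  then obtain n q where n: "run \<delta> q0 n = Some q" "pres_eq R w n" by blast
  then show ?case
    using step_normalizes[OF n(1), of x] pres_eq_append_right[OF n(2), of "[x]"] pres_eq.trans by blast
qed

abbreviation grp where "grp \<equiv> presented_group R"
abbreviation gen where "gen x \<equiv> pres_class R [x]"

definition nf_word :: "'x gword set \<Rightarrow> 'x gword" where
  "nf_word g = (THE y. (\<exists>q. run \<delta> q0 y = Some q) \<and> pres_class R y = g)"

lemma nf_word_class: "run \<delta> q0 y = Some q \<Longrightarrow> nf_word (pres_class R y) = y"
  unfolding nf_word_def
  by (rule the_equality) (use nf_unique in \<open>auto simp: pres_class_eq_iff\<close>)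

lemma carrier_nf:
  assumes "g \<in> carrier grp"
  obtains y q where "run \<delta> q0 y = Some q" "g = pres_class R y" "nf_word g = y"
proof -
  obtain w where w: "g = pres_class R w" using assms by (auto simp: presented_group_def)
  obtain y q where y: "run \<delta> q0 y = Some q" "pres_eq R w y" using nf_exists by blast
  then show thesis using that[of y q] w nf_word_class by (simp add: pres_class_eq_iff[symmetric])
qed

lemma class_carrier [simp]: "pres_class R w \<in> carrier grp"
  by (simp add: presented_group_def)

lemma foldl_class: "foldl (\<otimes>\<^bsub>grp\<^esub>) (pres_class R u) (map gen w) = pres_class R (u @ w)"
  by (induction w arbitrary: u) (simp_all add: presented_group_mult)

lemma one_class: "\<one>\<^bsub>grp\<^esub> = pres_class R []"
  by (simp add: presented_group_def)

lemma inj_gen: "inj gen"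
  by (rule injI) (simp only: pres_class_eq_iff letters_distinct)

lemma inv_letter: "inv\<^bsub>grp\<^esub> (gen x) = gen (flip_letter x)"
proof -
  interpret group grp by (rule group_presented_group)
  show ?thesis
    using cancel_last[of "[]" x]
    by (intro inv_equality) (simp_all add: presented_group_mult one_class pres_class_eq_iff)
qed

lemma generating_set: "inverse_closed_generating_set grp (range gen)"
proof -
  interpret group grp by (rule group_presented_group)
  have "pres_class R w \<in> generate grp (range gen)" for w
  proof (induction w)
    case Nil
    show ?case using generate.one[of grp "range gen"] by (simp add: one_class)
  next
    case (Cons x w)
    have "gen x \<otimes>\<^bsub>grp\<^esub> pres_class R w \<in> generate grp (range gen)"
      by (intro generate.eng generate.incl rangeI Cons)
    then show ?case by (simp add: presented_group_mult)
  qed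
  then have "carrier grp \<subseteq> generate grp (range gen)" by (auto simp: presented_group_def)
  then have "generate grp (range gen) = carrier grp"
    by (intro subset_antisym generate_incl image_subsetI class_carrier)
  moreover have "finite (range gen)" using finite_gens by (simp add: finite_prod)
  moreover have "\<one>\<^bsub>grp\<^esub> \<notin> range gen"
  proof
    assume "\<one>\<^bsub>grp\<^esub> \<in> range gen"
    then obtain x where "gen x = pres_class R []" unfolding one_class by (elim rangeE) simp
    then show False unfolding pres_class_eq_iff using letters_nontrivial by blast
  qed
  ultimately show ?thesis
    unfolding inverse_closed_generating_set_def by (auto simp: inv_letter)
qed

sublocale normal_form_tree grp "range gen" "\<lambda>g. map gen (nf_word g)"
proof -
  interpret group grp by (rule group_presented_group)
  show "normal_form_tree grp (range gen) (\<lambda>g. map gen (nf_word g))"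
  proof
    fix g assume g: "g \<in> carrier grp"
    then obtain y q where y: "run \<delta> q0 y = Some q" "g = pres_class R y" "nf_word g = y"
      by (rule carrier_nf)
    then show "foldl (\<otimes>\<^bsub>grp\<^esub>) \<one>\<^bsub>grp\<^esub> (map gen (nf_word g)) = g"
      by (simp add: one_class foldl_class)
    fix u a assume "map gen (nf_word g) = u @ [a]"
    then obtain z x where z: "y = z @ [x]" "u = map gen z"
      using y(3) by (auto simp: map_eq_append_conv)
    obtain q' where "run \<delta> q0 z = Some q'" using y(1) z(1) by (auto simp: run_append bind_eq_Some_conv)
    then show "map gen (nf_word (foldl (\<otimes>\<^bsub>grp\<^esub>) \<one>\<^bsub>grp\<^esub> u)) = u"
      by (simp add: z one_class foldl_class nf_word_class)
  qed (use generating_set in auto)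
qed

text \<open>This connects the tree of the Cayley graph to the predicate on words, which the remaining
  hypotheses use.\<close>

lemma arcs_T_iff:
  assumes y: "run \<delta> q0 y = Some q"
  shows "(pres_class R y, gen x) \<in> arcs T \<longleftrightarrow> tree_edge (val y) x"
proof -
  obtain n q' where n: "run \<delta> q0 n = Some q'" "pres_eq R (y @ [x]) n" using nf_exists by blast
  have nf_n: "nf_word (pres_class R y \<otimes>\<^bsub>grp\<^esub> gen x) = n"
    using nf_word_class[OF n(1)] n(2) by (simp add: presented_group_mult pres_class_eq_iff[symmetric])
  have "(pres_class R y, gen x) \<in> arcs T \<longleftrightarrow>
      map gen n = map gen (y @ [x]) \<or> map gen y = map gen (n @ [flip_letter x])"
    by (simp add: arcs_T nf_n nf_word_class[OF y] inv_letter)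
  also have "\<dots> \<longleftrightarrow> n = y @ [x] \<or> y = n @ [flip_letter x]"
    by (simp only: inj_map_eq_map[OF inj_gen])
  also have "\<dots> \<longleftrightarrow> tree_edge (val y) x"
  proof
    assume "n = y @ [x] \<or> y = n @ [flip_letter x]"
    then show "tree_edge (val y) x"
      using tree_edge_iff[OF y, of x] n(1) y by (auto simp: run_append)
  next
    assume "tree_edge (val y) x"
    then consider q'' where "\<delta> q x = Some q''" | z where "y = z @ [flip_letter x]"
      using tree_edge_iff[OF y, of x] by auto
    then show "n = y @ [x] \<or> y = n @ [flip_letter x]"
    proof cases
      case 1
      then have "run \<delta> q0 (y @ [x]) = Some q''" using y by (simp add: run_append)
      then show ?thesis using nf_unique n by (metis pres_eq.sym)
    next
      case (2 z)
      obtain q'' where "run \<delta> q0 z = Some q''"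
        using y 2 by (auto simp: run_append bind_eq_Some_conv)
      moreover have "pres_eq R z n"
        using cancel_last[of z x] n(2) by (metis 2 append_assoc pres_eq.sym pres_eq.trans)
      ultimately show ?thesis using nf_unique n(1) 2 by blast
    qed
  qed
  finally show ?thesis .
qed

text \<open>The stacking map is a finite union over the pairs of a state \<open>q\<close> and a letter \<open>x\<close>, with one
  fixed word as value for each pair; this gives regularity and the bound on path lengths.\<close>

theorem autostackable_presentation: "autostackable grp"
proof -
  define letter where "letter = the_inv gen"
  have letter [simp]: "letter (gen x) = x" for x
    unfolding letter_def by (rule the_inv_f_f[OF inj_gen])
  define \<phi> where "\<phi> g a = map gen (path (the (run \<delta> q0 (nf_word g))) (letter a))" for g a
  have \<phi>: "\<phi> (pres_class R y) (gen x) = map gen (path q x)" if "run \<delta> q0 y = Some q" for y q x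
    using that by (simp add: \<phi>_def nf_word_class)
  define k where "k = Max (range (\<lambda>(q, x). length (path q x)))"
  have "finite (UNIV :: ('s \<times> ('x \<times> bool)) set)" using finite_gens by (simp add: finite_prod)
  then have k: "length (path q x) \<le> k" for q x
    unfolding k_def by (intro Max_ge) (auto intro!: image_eqI[of _ _ "(q, x)"])
  have "autostackable_over grp (range gen)"
  proof (rule autostackable_over_if_flow)
    fix g a assume g: "g \<in> carrier grp" and "a \<in> range gen"
    then obtain x where a: "a = gen x" by blast
    obtain y q where y: "run \<delta> q0 y = Some q" "g = pres_class R y" "nf_word g = y"
      using carrier_nf[OF g] .
    show "set (\<phi> g a) \<subseteq> range gen" by (auto simp: \<phi>_def)
    show "foldl (\<otimes>\<^bsub>grp\<^esub>) g (\<phi> g a) = g \<otimes>\<^bsub>grp\<^esub> a"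
      using path_eq[OF y(1)] y
      by (simp add: a \<phi> foldl_class presented_group_mult pres_class_eq_iff pres_eq_append_left)
    show "length (\<phi> g a) \<le> k" using k by (simp add: \<phi>_def)
    fix p b t
    assume hard: "(g, a) \<notin> arcs T" and split: "\<phi> g a = p @ b # t"
      and hard': "(foldl (\<otimes>\<^bsub>grp\<^esub>) g p, b) \<notin> arcs T"
    obtain p' z t' where path: "path q x = p' @ z # t'" and p: "p = map gen p'" "b = gen z"
      using split y(1) by (auto simp: y(2) a \<phi> map_eq_append_conv map_eq_Cons_conv)
    have g': "foldl (\<otimes>\<^bsub>grp\<^esub>) g p = pres_class R (y @ p')" by (simp add: y(2) p foldl_class)
    obtain n q' where n: "run \<delta> q0 n = Some q'" "pres_eq R (y @ p') n" using nf_exists by blast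
    have n': "pres_class R (y @ p') = pres_class R n" using n(2) by (simp add: pres_class_eq_iff)
    have "\<not> tree_edge (val (y @ p')) z"
      using hard' arcs_T_iff[OF n(1)] val_eq[OF n(2)] unfolding g' n' p(2) by simp
    moreover have "\<not> tree_edge (val y) x" using hard arcs_T_iff[OF y(1)] by (simp add: y(2) a)
    ultimately have "((val (y @ p'), z), (val y, x)) \<in> r" using path_decreasing[OF y(1) _ path] by blast
    then show "((foldl (\<otimes>\<^bsub>grp\<^esub>) g p, b), (g, a)) \<in> inv_image r (\<lambda>(g, a). (val (nf_word g), letter a))"
      using val_eq[OF n(2)] y(3) unfolding g' n' p(2) a by (simp add: nf_word_class[OF n(1)])
  next
    fix g a assume ga: "(g, a) \<in> arcs T"
    then obtain x where a: "a = gen x" by (auto simp: arcs_T)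
    have "g \<in> carrier grp" using ga by (simp add: arcs_T)
    then obtain y q where y: "run \<delta> q0 y = Some q" "g = pres_class R y" "nf_word g = y"
      by (rule carrier_nf)
    then show "\<phi> g a = [a]" using ga arcs_T_iff[OF y(1)] path_tree[OF y(1)] by (simp add: a \<phi>)
  next
    show "wf (inv_image r (\<lambda>(g, a). (val (nf_word g), letter a)))" using wf by (rule wf_inv_image)
    have "{[map gen (nf_word g), [a], \<phi> g a] | g a. g \<in> carrier grp \<and> a \<in> range gen} =
        (\<Union>(q, x)\<in>UNIV. {[y, [gen x], map gen (path q x)] | y. y \<in> map gen ` {w. run \<delta> q0 w = Some q}})"
      (is "?L = ?R")
    proof
      show "?L \<subseteq> ?R"
      proof
        fix us assume "us \<in> ?L"
        then obtain g x where g: "g \<in> carrier grp" and us: "us = [map gen (nf_word g), [gen x], \<phi> g (gen x)]"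
          by blast
        obtain y q where "run \<delta> q0 y = Some q" "g = pres_class R y" "nf_word g = y"
          using carrier_nf[OF g] .
        then show "us \<in> ?R" by (intro UN_I[of "(q, x)"]) (simp_all add: us \<phi>)
      qed
      show "?R \<subseteq> ?L"
      proof
        fix us assume "us \<in> ?R"
        then obtain q x y where "run \<delta> q0 y = Some q" "us = [map gen y, [gen x], map gen (path q x)]"
          by auto
        then show "us \<in> ?L"
          by (intro CollectI exI[of _ "pres_class R y"] exI[of _ "gen x"]) (simp add: \<phi> nf_word_class)
      qed
    qed
    moreover have "synchronously_regular 3 (range gen) \<dots>"
      unfolding case_prod_unfold
      using \<open>finite (UNIV :: ('s \<times> ('x \<times> bool)) set)\<close>
      by (intro synchronously_regular_triples finite_derivatives_run inj_gen) auto
    ultimately show "synchronously_regular 3 (range gen)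
        {[map gen (nf_word g), [a], \<phi> g a] | g a. g \<in> carrier grp \<and> a \<in> range gen}"
      by simp
  qed
  then show ?thesis unfolding autostackable_def using generating_set by blast
qed

end

section \<open>Commuting words\<close>

lemma inv_word_simps [simp]:
  "inv_word [] = []" "inv_word (l # u) = inv_word u @ [flip_letter l]"
  "inv_word (u @ v) = inv_word v @ inv_word u"
  by (simp_all add: inv_word_def)

lemma inv_word_inv_word [simp]: "inv_word (inv_word u) = u"
  by (induction u) simp_all

lemma pres_eq_inv_right: "pres_eq R (u @ inv_word u) []"
  using pres_eq_inv_left[of R "inv_word u"] by simp

lemma pres_eq_cancel_mid: "pres_eq R w [] \<Longrightarrow> pres_eq R (u @ w @ v) (u @ v)"
  using pres_eq_append_left[OF pres_eq_append_right, of R w "[]" u v] by simp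

definition commute :: "'x gword set \<Rightarrow> 'x gword \<Rightarrow> 'x gword \<Rightarrow> bool" where
  "commute R u v \<longleftrightarrow> pres_eq R (u @ v) (v @ u)"

lemma commute_sym: "commute R u v \<Longrightarrow> commute R v u"
  unfolding commute_def by (rule pres_eq.sym)

lemma commute_append:
  assumes "commute R u v" "commute R u w"
  shows "commute R u (v @ w)"
  using pres_eq_append_right[OF assms(1)[unfolded commute_def], of w]
    pres_eq_append_left[OF assms(2)[unfolded commute_def], of v]
  unfolding commute_def by (auto intro: pres_eq.trans)

lemma commute_cong:
  assumes "commute R u v" "pres_eq R v v'"
  shows "commute R u v'"
  using assms unfolding commute_def
  by (meson pres_eq.sym pres_eq.trans pres_eq_append_left pres_eq_append_right)

lemma conjugate_commuting:
  assumes "commute R u v"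
  shows "pres_eq R (inv_word u @ v @ u) v"
proof -
  have "pres_eq R (inv_word u @ v @ u) (inv_word u @ u @ v)"
    using assms unfolding commute_def by (intro pres_eq_append_left) (rule pres_eq.sym)
  moreover have "pres_eq R (inv_word u @ u @ v) v"
    using pres_eq_cancel_mid[OF pres_eq_inv_left, of R "[]" u v] by simp
  ultimately show ?thesis by (rule pres_eq.trans)
qed

lemma commute_inv:
  assumes "commute R u v"
  shows "commute R (inv_word u) v"
proof -
  have "pres_eq R (inv_word u @ v) (inv_word u @ v @ u @ inv_word u)"
    using pres_eq_cancel_mid[OF pres_eq_inv_right, of R "inv_word u @ v" u "[]"]
    by (auto intro: pres_eq.sym)
  moreover have "pres_eq R (inv_word u @ v @ u @ inv_word u) (v @ inv_word u)"
    using pres_eq_append_right[OF conjugate_commuting[OF assms], of "inv_word u"] by simp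
  ultimately show ?thesis unfolding commute_def by (rule pres_eq.trans)
qed

lemma commute_relator:
  assumes "commutator_word u v \<in> R"
  shows "commute R u v"
proof -
  have "pres_eq R (commutator_word u v @ v @ u) (v @ u)"
    using pres_eq.relator[OF assms, of "[]" "v @ u"] by simp
  moreover have "pres_eq R (commutator_word u v @ v @ u) (u @ v @ inv_word u @ u)"
    using pres_eq_cancel_mid[OF pres_eq_inv_left, of R "u @ v @ inv_word u" v u]
    by (simp add: commutator_word_def)
  moreover have "pres_eq R (u @ v @ inv_word u @ u) (u @ v)"
    using pres_eq_cancel_mid[OF pres_eq_inv_left, of R "u @ v" u "[]"] by simp
  ultimately show ?thesis unfolding commute_def by (blast intro: pres_eq.sym pres_eq.trans)
qed

lemma commute_letters:
  assumes "commutator_word (gen_word g) (gen_word h) \<in> R"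
  shows "commute R [(g, e)] [(h, e')]"
proof -
  have "commute R [(g, False)] [(h, False)]"
    using commute_relator[OF assms] by (simp add: gen_word_def)
  then have *: "commute R [(g, False)] [(h, e')]"
    using commute_sym commute_inv[of R "[(h, False)]" "[(g, False)]"] by (cases e') auto
  then show ?thesis using commute_inv[of R "[(g, False)]" "[(h, e')]"] by (cases e) auto
qed

abbreviation "SR \<equiv> stallings_relators"

lemma commute_ab_cd:
  assumes "fst l \<in> {Sa, Sb}" "fst m \<in> {Sc, Sd}"
  shows "commute SR [l] [m]" "commute SR [m] [l]"
proof -
  show "commute SR [l] [m]"
    using assms commute_letters[of "fst l" "fst m" SR "snd l" "snd m"]
    by (auto simp: stallings_relators_def)
  then show "commute SR [m] [l]" by (rule commute_sym)
qed

lemma commute_s_positive: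
  assumes "g \<in> {Sb, Sc, Sd}"
  shows "commute SR [(Ss, False)] [(Sa, False), (g, True)]"
    and "commute SR [(Ss, False)] [(g, False), (Sa, True)]"
proof -
  have "commutator_word (gen_word Ss) (gen_word Sa @ inv_word (gen_word g)) \<in> SR"
    using assms by (auto simp: stallings_relators_def)
  from commute_relator[OF this]
  show *: "commute SR [(Ss, False)] [(Sa, False), (g, True)]" by (simp add: gen_word_def)
  show "commute SR [(Ss, False)] [(g, False), (Sa, True)]"
    using commute_sym[OF commute_inv[OF commute_sym[OF *]]] by simp
qed

text \<open>The relators provide \<open>b a\<^sup>-\<^sup>1\<close> and its inverse \<open>a b\<^sup>-\<^sup>1\<close>, but the flow also needs \<open>b\<^sup>-\<^sup>1 a\<close>. Since
  \<open>c\<close> commutes with \<open>a\<close> and \<open>b\<close>, this is \<open>c (b\<^sup>-\<^sup>1 a) c\<^sup>-\<^sup>1 = (c a\<^sup>-\<^sup>1) (a b\<^sup>-\<^sup>1) (a c\<^sup>-\<^sup>1)\<close>, a product of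
  elements that commute with \<open>s\<close>.\<close>

lemma commute_s_inverse_b: "commute SR [(Ss, False)] [(Sb, True), (Sa, False)]"
proof -
  let ?s = "[(Ss, False)]"
  have "commute SR ?s ([(Sc, False), (Sa, True)] @ [(Sa, False), (Sb, True)] @ [(Sa, False), (Sc, True)])"
    by (intro commute_append commute_s_positive) auto
  moreover have "pres_eq SR ([(Sc, False), (Sa, True)] @ [(Sa, False), (Sb, True)] @ [(Sa, False), (Sc, True)])
      ([(Sc, False), (Sb, True), (Sa, False), (Sc, True)])"
    using pres_eq.cancel[of SR "[(Sc, False)]" "(Sa, True)" "[(Sb, True), (Sa, False), (Sc, True)]"] by simp
  moreover have "pres_eq SR [(Sc, False), (Sb, True), (Sa, False), (Sc, True)] [(Sb, True), (Sa, False)]"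
    using conjugate_commuting[OF commute_append, of SR "[(Sc, True)]" "[(Sb, True)]" "[(Sa, False)]"]
      commute_ab_cd(2)[of _ "(Sc, True)"] by simp
  ultimately show ?thesis by (meson commute_cong)
qed

text \<open>These elements of \<open>N\<close> are the ones that the flow moves across \<open>s\<close>.\<close>

lemma commute_s_kernel:
  assumes "fst l = Ss" "fst x \<in> {Sb, Sc, Sd}"
  shows "commute SR [l] [x, (Sa, \<not> snd x)]"
proof -
  obtain g e where x: "x = (g, e)" by fastforce
  have "commute SR [(Ss, False)] [x, (Sa, \<not> e)]"
  proof (cases e)
    case False
    then show ?thesis using commute_s_positive(2)[of g] assms(2) by (simp add: x)
  next
    case True
    show ?thesis
    proof (cases "g = Sb")
      case True
      then show ?thesis using commute_s_inverse_b \<open>e\<close> by (simp add: x)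
    next
      case False
      then have "commute SR [(Sa, False)] [(g, True)]" using assms(2) by (intro commute_ab_cd) (auto simp: x)
      then show ?thesis
        using commute_cong[OF commute_s_positive(1)[of g], of "[(g, True), (Sa, False)]"] assms(2) \<open>e\<close>
        by (simp add: x commute_def)
    qed
  qed
  moreover obtain b where "l = (Ss, b)" using assms(1) by (cases l) auto
  ultimately show ?thesis
    using commute_inv[of SR "[(Ss, False)]" "[x, (Sa, \<not> e)]"] by (cases b) (simp_all add: x)
qed

section \<open>Invariants of elements of Stallings' group\<close>

text \<open>Words are stored as stacks, the last letter first, because generators act by multiplication
  on the right and the last letter decides about cancellation.\<close>

definition push :: "'x \<times> bool \<Rightarrow> 'x gword \<Rightarrow> 'x gword" where
  "push l w = (case w of [] \<Rightarrow> [l] | m # w' \<Rightarrow> if m = flip_letter l then w' else l # w)"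

fun reduced :: "'x gword \<Rightarrow> bool" where
  "reduced (l # m # w) \<longleftrightarrow> m \<noteq> flip_letter l \<and> reduced (m # w)"
| "reduced _ \<longleftrightarrow> True"

lemma reduced_tl: "reduced (l # w) \<Longrightarrow> reduced w"
  by (cases w) auto

lemma reduced_push: "reduced w \<Longrightarrow> reduced (push l w)"
  by (cases w) (auto simp: push_def dest: reduced_tl)

lemma push_Cons: "reduced (l # w) \<Longrightarrow> push l w = l # w"
  by (cases w) (auto simp: push_def)

lemma push_flip: "reduced w \<Longrightarrow> push (flip_letter l) (push l w) = w"
proof (cases w)
  case (Cons m w')
  assume "reduced w"
  show ?thesis
  proof (cases "m = flip_letter l")
    case True
    then show ?thesis using \<open>reduced w\<close> Cons push_Cons[of m w'] by (simp add: push_def)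
  qed (simp add: push_def Cons)
qed (simp add: push_def)

text \<open>An action of the free monoid on letters descends to the presented group as soon as opposite
  letters and relators act trivially. The predicate \<open>valid\<close> restricts the set acted upon, because
  on stacks that are not reduced opposite letters need not cancel.\<close>

lemma pres_eq_fold:
  assumes "pres_eq R u v" "valid t"
    and closed: "\<And>l t. valid t \<Longrightarrow> valid (act l t)"
    and cancel: "\<And>l t. valid t \<Longrightarrow> act (flip_letter l) (act l t) = t"
    and relators: "\<And>w t. \<lbrakk>w \<in> R; valid t\<rbrakk> \<Longrightarrow> fold act w t = t"
  shows "fold act u t = fold act v t"
proof -
  have valid_fold: "valid t \<Longrightarrow> valid (fold act w t)" for w t
    by (induction w arbitrary: t) (auto intro: closed)
  show ?thesis
    using assms(1,2)
  proof (induction arbitrary: t rule: pres_eq.induct)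
    case (cancel u l v)
    then show ?case using assms(4)[OF valid_fold, of t l u] by simp
  next
    case (relator w u v)
    then show ?case using relators[OF _ valid_fold] by simp
  qed auto
qed

definition act_u :: "stallings_gen \<times> bool \<Rightarrow> stallings_gen gword \<Rightarrow> stallings_gen gword" where
  "act_u l u = (if fst l \<in> {Sa, Sb} then push l u else u)"

definition act_v :: "stallings_gen \<times> bool \<Rightarrow> stallings_gen gword \<Rightarrow> stallings_gen gword" where
  "act_v l v = (if fst l \<in> {Sc, Sd} then push l v else v)"

text \<open>The right action on the right cosets of \<open>\<langle>a, b, c, d\<rangle>\<close>. The empty stack is the coset of the
  identity, which \<open>a, b, c, d\<close> fix. On every other coset these four letters act alike, since they
  agree modulo the normal subgroup \<open>N\<close>.\<close>

definition act_w :: "stallings_gen \<times> bool \<Rightarrow> stallings_gen gword \<Rightarrow> stallings_gen gword" where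
  "act_w l w = (if fst l = Ss then push l w else if w = [] then [] else push (Sa, snd l) w)"

definition valid_w :: "stallings_gen gword \<Rightarrow> bool" where
  "valid_w w \<longleftrightarrow> reduced w \<and> (w \<noteq> [] \<longrightarrow> fst (last w) = Ss)"

text \<open>The letter at the bottom of a nonempty stack is \<open>s\<close> or its inverse, which \<open>a\<close> cannot cancel.\<close>

lemma push_a_nonempty: "\<lbrakk>valid_w w; w \<noteq> []\<rbrakk> \<Longrightarrow> push (Sa, e) w \<noteq> []"
  by (cases w) (auto simp: push_def valid_w_def)

lemma valid_act_w: "valid_w w \<Longrightarrow> valid_w (act_w l w)"
  by (cases w) (auto simp: act_w_def valid_w_def reduced_push push_def dest: reduced_tl)

lemma act_w_flip: "valid_w w \<Longrightarrow> act_w (flip_letter l) (act_w l w) = w"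
  using push_flip[of w l] push_flip[of w "(Sa, snd l)"] push_a_nonempty[of w "snd l"]
  by (auto simp: act_w_def valid_w_def)

lemma act_w_a:
  "fst l \<noteq> Ss \<Longrightarrow> act_w l w = act_w (Sa, snd l) w"
  by (simp add: act_w_def)

lemma fold_act_u_eq:
  assumes "pres_eq SR x y" "reduced u"
  shows "fold act_u x u = fold act_u y u"
  using assms
proof (rule pres_eq_fold[where valid = reduced])
  fix l and t :: "stallings_gen gword" assume t: "reduced t"
  show "reduced (act_u l t)" using t by (simp add: act_u_def reduced_push)
  show "act_u (flip_letter l) (act_u l t) = t" using push_flip[OF t] by (simp add: act_u_def)
next
  fix r and t :: "stallings_gen gword" assume "r \<in> SR" and t: "reduced t"
  have cancel: "push (g, True) (push (g, False) t') = t'" "push (g, False) (push (g, True) t') = t'"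
    if "reduced t'" for g :: stallings_gen and t'
    using push_flip[OF that, of "(g, False)"] push_flip[OF that, of "(g, True)"] by simp_all
  show "fold act_u r t = t"
    using \<open>r \<in> SR\<close> t
    by (auto simp: stallings_relators_def commutator_word_def gen_word_def act_u_def cancel reduced_push)
qed

lemma fold_act_v_eq:
  assumes "pres_eq SR x y" "reduced v"
  shows "fold act_v x v = fold act_v y v"
  using assms
proof (rule pres_eq_fold[where valid = reduced])
  fix l and t :: "stallings_gen gword" assume t: "reduced t"
  show "reduced (act_v l t)" using t by (simp add: act_v_def reduced_push)
  show "act_v (flip_letter l) (act_v l t) = t" using push_flip[OF t] by (simp add: act_v_def)
next
  fix r and t :: "stallings_gen gword" assume "r \<in> SR" and t: "reduced t"
  have cancel: "push (g, True) (push (g, False) t') = t'" "push (g, False) (push (g, True) t') = t'"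
    if "reduced t'" for g :: stallings_gen and t'
    using push_flip[OF that, of "(g, False)"] push_flip[OF that, of "(g, True)"] by simp_all
  show "fold act_v r t = t"
    using \<open>r \<in> SR\<close> t
    by (auto simp: stallings_relators_def commutator_word_def gen_word_def act_v_def cancel reduced_push)
qed

lemma fold_act_w_eq:
  assumes "pres_eq SR x y" "valid_w w"
  shows "fold act_w x w = fold act_w y w"
  using assms
proof (rule pres_eq_fold[where valid = valid_w])
  fix w' t assume "w' \<in> SR" and t: "valid_w t"
  have a: "act_w (g, e) = act_w (Sa, e)" if "g \<in> {Sb, Sc, Sd}" for g e
    using that by (auto simp: act_w_def fun_eq_iff)
  have cancel: "act_w (g, True) (act_w (g, False) t') = t'" "act_w (g, False) (act_w (g, True) t') = t'"
    if "valid_w t'" for g t'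
    using act_w_flip[OF that, of "(g, False)"] act_w_flip[OF that, of "(g, True)"] by simp_all
  show "fold act_w w' t = t"
    using \<open>w' \<in> SR\<close> t
    by (auto simp: stallings_relators_def commutator_word_def gen_word_def a cancel valid_act_w)
qed (simp_all only: valid_act_w act_w_flip)

definition val :: "stallings_gen gword \<Rightarrow> stallings_gen gword \<times> stallings_gen gword" where
  "val x = (fold act_v x [], fold act_w x [])"

lemma valid_w_Nil [simp]: "valid_w []"
  by (simp add: valid_w_def)

lemma val_eq: "pres_eq SR x y \<Longrightarrow> val x = val y"
  using fold_act_v_eq[of x y "[]"] fold_act_w_eq[of x y "[]"] by (simp add: val_def)

lemma val_append: "val (x @ p) = (fold act_v p (fst (val x)), fold act_w p (snd (val x)))"
  by (simp add: val_def)

section \<open>Normal forms in Stallings' group\<close>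

instance stallings_gen :: finite
proof
  have "(UNIV :: stallings_gen set) \<subseteq> {Sa, Sb, Sc, Sd, Ss}"
    using stallings_gen.exhaust by blast
  then show "finite (UNIV :: stallings_gen set)" by (rule finite_subset) simp
qed

type_synonym nf_state = "(stallings_gen \<times> bool) option \<times> bool"

text \<open>A state is the last letter read, if any, together with a flag that records whether \<open>s\<close> or
  \<open>s\<^sup>-\<^sup>1\<close> has been read, that is, whether the block \<open>w\<close> is nonempty. As long as it is empty, the
  last letter tells whether the block \<open>v\<close> is.\<close>

definition nf_step :: "nf_state \<Rightarrow> stallings_gen \<times> bool \<Rightarrow> nf_state option" where
  "nf_step q x =
    (if fst q \<noteq> Some (flip_letter x) \<and>
        (case fst x of
           Ss \<Rightarrow> True
         | Sa \<Rightarrow> snd q \<or> fst q = None \<or> fst (the (fst q)) \<in> {Sa, Sb}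
         | Sb \<Rightarrow> \<not> snd q \<and> (fst q = None \<or> fst (the (fst q)) \<in> {Sa, Sb})
         | _ \<Rightarrow> \<not> snd q)
     then Some (Some x, snd q \<or> fst x = Ss) else None)"

abbreviation "nf_run \<equiv> run nf_step (None, False)"

text \<open>The three blocks of a normal form as stacks. The bottom letter of \<open>w\<close>, required by \<open>valid_w\<close>
  to come from \<open>s\<close>, is the first letter of the block.\<close>

definition nf_blocks ::
    "stallings_gen gword \<Rightarrow> stallings_gen gword \<Rightarrow> stallings_gen gword \<Rightarrow> bool" where
  "nf_blocks u v w \<longleftrightarrow> reduced u \<and> reduced v \<and> valid_w w \<and>
    fst ` set u \<subseteq> {Sa, Sb} \<and> fst ` set v \<subseteq> {Sc, Sd} \<and> fst ` set w \<subseteq> {Sa, Ss}"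

lemma nf_run_blocks:
  assumes "nf_run y = Some q"
  obtains u v w where "y = rev u @ rev v @ rev w" "nf_blocks u v w"
    "q = (head_letter (w @ v @ u), w \<noteq> [])"
proof -
  have "\<exists>u v w. y = rev u @ rev v @ rev w \<and> nf_blocks u v w \<and> q = (head_letter (w @ v @ u), w \<noteq> [])"
    using assms
  proof (induction y arbitrary: q rule: rev_induct)
    case Nil
    then show ?case by (intro exI[of _ "[]"]) (simp add: nf_blocks_def)
  next
    case (snoc x y)
    then obtain q' where "nf_run y = Some q'" and step: "nf_step q' x = Some q"
      by (auto simp: run_append bind_eq_Some_conv)
    then obtain u v w where y: "y = rev u @ rev v @ rev w" and blocks: "nf_blocks u v w"
      and q': "q' = (head_letter (w @ v @ u), w \<noteq> [])"
      using snoc.IH by blast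
    have q: "q = (Some x, w \<noteq> [] \<or> fst x = Ss)"
      using step by (auto simp: nf_step_def q' split: if_splits)
    have last: "head_letter (w @ v @ u) \<noteq> Some (flip_letter x)"
      using step by (auto simp: nf_step_def q' split: if_splits)
    consider "w \<noteq> [] \<or> fst x = Ss" "fst x \<in> {Sa, Ss}" | "w = []" "fst x \<in> {Sc, Sd}"
      | "w = []" "v = []" "fst x \<in> {Sa, Sb}"
    proof -
      have "v = []" if "w = []" "fst x \<in> {Sa, Sb}"
        using step blocks that
        by (cases v) (auto simp: nf_step_def q' nf_blocks_def split: if_splits stallings_gen.splits)
      moreover have "w = []" if "fst x \<in> {Sb, Sc, Sd}"
        using step that by (auto simp: nf_step_def q' split: if_splits)
      ultimately show thesis using that by (cases "fst x") auto
    qed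
    then show ?case
    proof cases
      case 1
      have "nf_blocks u v (x # w)"
        using blocks last 1 by (cases w) (auto simp: nf_blocks_def valid_w_def)
      then show ?thesis using y q 1 by (intro exI[of _ u] exI[of _ v] exI[of _ "x # w"]) simp
    next
      case 2
      have "nf_blocks u (x # v) []"
        using blocks last 2 by (cases v) (auto simp: nf_blocks_def)
      then show ?thesis using y q 2 by (intro exI[of _ u] exI[of _ "x # v"] exI[of _ "[]"]) auto
    next
      case 3
      have "nf_blocks (x # u) [] []"
        using blocks last 3 by (cases u) (auto simp: nf_blocks_def)
      then show ?thesis using y q 3 by (intro exI[of _ "x # u"] exI[of _ "[]"]) auto
    qed
  qed
  then show thesis using that by blast
qed

lemma fold_trivial: "(\<And>x. x \<in> set xs \<Longrightarrow> f x t = t) \<Longrightarrow> fold f xs t = t"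
  by (induction xs) auto

lemma fold_push_rev:
  assumes "reduced u" "\<And>x t. x \<in> set u \<Longrightarrow> act x t = push x t"
  shows "fold act (rev u) [] = u"
  using assms
proof (induction u)
  case (Cons x u)
  then have "fold act (rev u) [] = u" using reduced_tl[of x u] by simp
  then show ?case using Cons.prems push_Cons by simp
qed simp

lemma fold_act_u_blocks:
  assumes "nf_blocks u v w"
  shows "fold act_u (rev u @ rev v @ rev w) [] = fold act_u (rev w) u"
proof -
  have "fold act_u (rev u) [] = u"
    using assms by (intro fold_push_rev) (auto simp: nf_blocks_def act_u_def)
  moreover have "fold act_u (rev v) u = u"
    using assms by (intro fold_trivial) (auto simp: nf_blocks_def act_u_def)
  ultimately show ?thesis using assms by (simp add: nf_blocks_def)
qed

lemma val_blocks:
  assumes "nf_blocks u v w"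
  shows "val (rev u @ rev v @ rev w) = (v, w)"
proof -
  have u: "fold act_v (rev u) [] = []" and w: "fold act_v (rev w) v = v"
    using assms by (intro fold_trivial; auto simp: nf_blocks_def act_v_def)+
  have v: "fold act_v (rev v) [] = v"
    using assms by (intro fold_push_rev) (auto simp: nf_blocks_def act_v_def)
  have uv: "fold act_w (rev u) [] = []" "fold act_w (rev v) [] = []"
    using assms by (intro fold_trivial; auto simp: nf_blocks_def act_w_def)+
  have "valid_w w \<Longrightarrow> fst ` set w \<subseteq> {Sa, Ss} \<Longrightarrow> fold act_w (rev w) [] = w"
  proof (induction w)
    case (Cons x w)
    then have "valid_w w" using reduced_tl[of x w] by (auto simp: valid_w_def)
    then have "fold act_w (rev w) [] = w" using Cons by simp
    moreover have push: "push x w = x # w"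
      using Cons.prems push_Cons[of x w] by (simp add: valid_w_def)
    have "act_w x w = x # w"
    proof (cases "fst x = Ss")
      case True
      then show ?thesis by (simp add: act_w_def push)
    next
      case False
      then have "(Sa, snd x) = x" "w \<noteq> []"
        using Cons.prems by (auto simp: valid_w_def prod_eq_iff)
      then show ?thesis using False by (simp add: act_w_def push)
    qed
    ultimately show ?case by simp
  qed simp
  then show ?thesis using assms u v w uv by (simp add: val_def nf_blocks_def)
qed

lemma fold_act_u_inj:
  "\<lbrakk>fold act_u x u = fold act_u x u'; reduced u; reduced u'\<rbrakk> \<Longrightarrow> u = u'"
proof (induction x arbitrary: u u')
  case (Cons l x)
  have "reduced (act_u l u)" "reduced (act_u l u')"
    using Cons.prems by (simp_all add: act_u_def reduced_push)
  then have "act_u l u = act_u l u'" using Cons by auto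
  then show ?case using Cons.prems push_flip by (metis act_u_def)
qed simp

text \<open>The invariants \<open>v\<close> and \<open>w\<close> are blocks of the normal form themselves. The third invariant is
  the product of \<open>u\<close> with the part of \<open>w\<close> in \<open>a\<close>, and \<open>w\<close> being known, \<open>u\<close> can be recovered from
  it.\<close>

lemma nf_unique:
  assumes "nf_run y = Some q" "nf_run y' = Some q'" "pres_eq SR y y'"
  shows "y = y'"
proof -
  obtain u v w where y: "y = rev u @ rev v @ rev w" and b: "nf_blocks u v w"
    using nf_run_blocks[OF assms(1)] by metis
  obtain u' v' w' where y': "y' = rev u' @ rev v' @ rev w'" and b': "nf_blocks u' v' w'"
    using nf_run_blocks[OF assms(2)] by metis
  have vw: "v = v'" "w = w'" using val_eq[OF assms(3)] val_blocks[OF b] val_blocks[OF b'] by (simp_all add: y y')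
  have "fold act_u y [] = fold act_u y' []" by (rule fold_act_u_eq[OF assms(3)]) simp
  then have "fold act_u (rev w) u = fold act_u (rev w') u'"
    unfolding y y' fold_act_u_blocks[OF b] fold_act_u_blocks[OF b'] .
  moreover have "reduced u" "reduced u'" using b b' by (simp_all add: nf_blocks_def)
  ultimately have "u = u'" unfolding vw(2) by (rule fold_act_u_inj)
  then show ?thesis by (simp add: y y' vw)
qed

section \<open>The flow on Stallings' group\<close>

text \<open>An edge starts at an element with blocks \<open>v\<close> and \<open>w\<close>; whether it belongs to the tree does
  not depend on \<open>u\<close>.\<close>

fun tree_edge :: "stallings_gen gword \<times> stallings_gen gword \<Rightarrow> stallings_gen \<times> bool \<Rightarrow> bool" where
  "tree_edge (v, w) x \<longleftrightarrow>
    (case fst x of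
       Ss \<Rightarrow> True
     | Sa \<Rightarrow> w \<noteq> [] \<or> v = []
     | Sb \<Rightarrow> w = [] \<and> v = []
     | _ \<Rightarrow> w = [])"

fun flow_path :: "nf_state \<Rightarrow> stallings_gen \<times> bool \<Rightarrow> stallings_gen gword" where
  "flow_path (None, _) x = [x]"
| "flow_path (Some l, False) x =
    (if fst l \<in> {Sc, Sd} \<and> fst x \<in> {Sa, Sb} then [flip_letter l, x, l] else [x])"
| "flow_path (Some l, True) x =
    (if fst x \<in> {Sa, Ss} then [x]
     else if fst l = Ss then [flip_letter l, x, (Sa, \<not> snd x), l, (Sa, snd x)]
     else if fst x = Sb then [(Sc, \<not> snd l), x, (Sc, snd l)]
     else [flip_letter l, x, l])"

text \<open>In the lexicographic order an edge with nonempty \<open>w\<close> is above all edges with empty \<open>w\<close>,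
  regardless of \<open>v\<close>. The summand for \<open>b\<close> is needed because the paths of edges labeled \<open>b\<close> use
  edges labeled \<open>c\<close> at vertices whose block \<open>w\<close> is equally long.\<close>

fun complexity :: "(stallings_gen gword \<times> stallings_gen gword) \<times> (stallings_gen \<times> bool) \<Rightarrow> nat \<times> nat" where
  "complexity ((v, w), x) =
    (if w = [] then 0 else 2 * length w + (if fst x = Sb then 1 else 0), length v)"

abbreviation "simpler \<equiv> inv_image (less_than <*lex*> less_than) complexity"

lemma nf_tree_edge_iff:
  assumes "nf_run y = Some q"
  shows "tree_edge (val y) x \<longleftrightarrow> nf_step q x \<noteq> None \<or> (\<exists>z. y = z @ [flip_letter x])"
proof -
  obtain u v w where y: "y = rev u @ rev v @ rev w" and b: "nf_blocks u v w"
    and q: "q = (head_letter (w @ v @ u), w \<noteq> [])"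
    using nf_run_blocks[OF assms] by metis
  have "rev y = w @ v @ u" by (simp add: y)
  then have last: "(\<exists>z. y = z @ [flip_letter x]) \<longleftrightarrow> head_letter (w @ v @ u) = Some (flip_letter x)"
    by (metis head_letter_Some rev.simps(2) rev_rev_ident)
  consider l w' where "w = l # w'" | l v' where "w = []" "v = l # v'"
    | l u' where "w = []" "v = []" "u = l # u'" | "w = []" "v = []" "u = []"
    by (cases w; cases v; cases u) auto
  then show ?thesis
    unfolding last unfolding y val_blocks[OF b] q using b
    by cases (auto simp: nf_step_def nf_blocks_def split: stallings_gen.splits)
qed

lemma flow_path_tree:
  assumes "nf_run y = Some q" "tree_edge (val y) x"
  shows "flow_path q x = [x]"
proof -
  obtain u v w where y: "y = rev u @ rev v @ rev w" and b: "nf_blocks u v w"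
    and q: "q = (head_letter (w @ v @ u), w \<noteq> [])"
    using nf_run_blocks[OF assms(1)] by metis
  consider l w' where "w = l # w'" | l v' where "w = []" "v = l # v'"
    | l u' where "w = []" "v = []" "u = l # u'" | "w = []" "v = []" "u = []"
    by (cases w; cases v; cases u) auto
  then show ?thesis
    using assms(2) b unfolding y val_blocks[OF b] q
    by cases (auto simp: nf_blocks_def split: stallings_gen.splits)
qed

lemma conjugate_letter:
  assumes "commute SR [l] [x]"
  shows "pres_eq SR [flip_letter l, x, l] [x]"
  using conjugate_commuting[OF assms] by simp

lemma flow_path_eq:
  assumes "nf_run y = Some q"
  shows "pres_eq SR (flow_path q x) [x]"
proof -
  obtain u v w where b: "nf_blocks u v w" and q: "q = (head_letter (w @ v @ u), w \<noteq> [])"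
    using nf_run_blocks[OF assms] by metis
  consider l w' where "w = l # w'" | l where "w = []" "head_letter (v @ u) = Some l"
    | "w = []" "v = []" "u = []"
    by (cases w; cases v; cases u) auto
  then show ?thesis
  proof cases
    case (1 l w')
    then have l: "fst l \<in> {Sa, Ss}" and q: "q = (Some l, True)" using b by (auto simp: q nf_blocks_def)
    consider "fst x \<in> {Sa, Ss}" | "fst l = Ss" "fst x \<in> {Sb, Sc, Sd}" | "fst l = Sa" "fst x = Sb"
      | "fst l = Sa" "fst x \<in> {Sc, Sd}"
      using l by (cases "fst x") auto
    then show ?thesis
    proof cases
      case 1
      then show ?thesis by (simp add: q pres_eq.refl)
    next
      case 2
      have "pres_eq SR ([flip_letter l, x, (Sa, \<not> snd x), l] @ [(Sa, snd x)]) ([x, (Sa, \<not> snd x)] @ [(Sa, snd x)])"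
        using conjugate_commuting[OF commute_s_kernel[OF 2]] by (intro pres_eq_append_right) simp
      moreover have "pres_eq SR ([x, (Sa, \<not> snd x)] @ [(Sa, snd x)]) [x]"
        using pres_eq.cancel[of SR "[x]" "(Sa, \<not> snd x)" "[]"] by simp
      ultimately have "pres_eq SR ([flip_letter l, x, (Sa, \<not> snd x), l] @ [(Sa, snd x)]) [x]"
        by (rule pres_eq.trans)
      then show ?thesis using 2 by (auto simp: q)
    next
      case 3
      then show ?thesis
        using conjugate_letter[OF commute_ab_cd(2)[of x "(Sc, snd l)"]] by (simp add: q)
    next
      case 4
      then show ?thesis
        using conjugate_letter[OF commute_ab_cd(1)[of l x]] by (auto simp: q)
    qed
  next
    case (2 l)
    then have q: "q = (Some l, False)" by (simp add: q)
    show ?thesis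
      using conjugate_letter[OF commute_ab_cd(2)[of x l]] pres_eq.refl by (auto simp: q)
  next
    case 3
    then show ?thesis by (simp add: q pres_eq.refl)
  qed
qed

text \<open>Traverses a path from a vertex with blocks \<open>v\<close> and \<open>w\<close>, checking each edge against the edge
  \<open>e\<close> and updating the blocks. On the explicit paths of the flow the simplifier can run this
  check.\<close>

fun descends ::
    "(stallings_gen gword \<times> stallings_gen gword) \<times> (stallings_gen \<times> bool) \<Rightarrow>
      stallings_gen gword \<times> stallings_gen gword \<Rightarrow> stallings_gen gword \<Rightarrow> bool" where
  "descends e (v, w) [] \<longleftrightarrow> True"
| "descends e (v, w) (z # p) \<longleftrightarrow>
    (tree_edge (v, w) z \<or> (((v, w), z), e) \<in> simpler) \<and> descends e (act_v z v, act_w z w) p"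

lemma descends_append:
  "descends e (v, w) (p @ t) \<Longrightarrow> descends e (fold act_v p v, fold act_w p w) t"
  by (induction p arbitrary: v w) auto

text \<open>Removing the last letter \<open>l\<close> of the normal form gives a shorter block, at which the edge
  labeled \<open>x\<close> is simpler. If \<open>l\<close> is \<open>s\<close> or its inverse, the edge labeled \<open>a\<^sup>\<mp>\<^sup>1\<close> that follows starts
  at a vertex where \<open>w\<close> is either nonempty, so that it is a tree edge, or empty, so that it is
  simpler than every edge with nonempty \<open>w\<close>.\<close>

lemma flow_path_descends:
  assumes "nf_run y = Some q" "\<not> tree_edge (val y) x"
  shows "descends (val y, x) (val y) (flow_path q x)"
proof -
  obtain u v w where y: "y = rev u @ rev v @ rev w" and b: "nf_blocks u v w"
    and q: "q = (head_letter (w @ v @ u), w \<noteq> [])"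
    using nf_run_blocks[OF assms(1)] by metis
  have val: "val y = (v, w)" using val_blocks[OF b] by (simp add: y)
  have hard: "\<not> tree_edge (v, w) x" using assms(2) by (simp add: val)
  show ?thesis
  proof (cases w)
    case Nil
    then have x: "fst x \<in> {Sa, Sb}" and "v \<noteq> []"
      using hard by (auto split: stallings_gen.splits)
    then obtain l v' where v: "v = l # v'" by (cases v) auto
    have l: "fst l \<in> {Sc, Sd}" using b by (auto simp: nf_blocks_def v)
    have "act_v (flip_letter l) v = v'" using l by (auto simp: act_v_def push_def v)
    then show ?thesis
      using l x Nil by (auto simp: val q v act_w_def split: stallings_gen.splits)
  next
    case (Cons l w')
    have valid: "valid_w w" "valid_w w'"
      using b by (auto simp: Cons nf_blocks_def valid_w_def dest: reduced_tl)
    have red: "reduced (l # w')" using valid(1) by (simp add: Cons valid_w_def)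
    have l: "fst l \<in> {Sa, Ss}" using b by (auto simp: nf_blocks_def Cons)
    have q: "q = (Some l, True)" by (simp add: q Cons)
    have x: "fst x \<in> {Sb, Sc, Sd}" using hard by (auto simp: Cons split: stallings_gen.splits)
    have ax: "act_w x w' = act_w (Sa, snd x) w'" using x by (intro act_w_a) auto
    show ?thesis
    proof (cases "fst l = Ss")
      case True
      then obtain e where l: "l = (Ss, e)" by (cases l) auto
      have 1: "act_w (Ss, \<not> e) (l # w') = w'" by (simp add: act_w_def push_def l)
      have 2: "act_w (Sa, \<not> snd x) (act_w x w') = w'"
        using act_w_flip[OF valid(2), of "(Sa, snd x)"] by (simp add: ax)
      have 3: "act_w (Ss, e) w' = l # w'" using push_Cons[OF red] by (simp add: act_w_def l)
      have 4: "act_w x w' = [] \<longleftrightarrow> w' = []"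
        unfolding ax unfolding act_w_def using push_a_nonempty[OF valid(2)] by auto
      show ?thesis
        unfolding val q Cons using x by (auto simp: l 1[unfolded l] 2 3[unfolded l] 4)
    next
      case False
      then have "fst l = Sa" using l by simp
      then have l: "l = (Sa, snd l)" by (simp add: prod_eq_iff)
      have "w' \<noteq> []" using valid(1) False by (auto simp: Cons valid_w_def)
      have 1: "act_w z (l # w') = w'" if "fst z \<noteq> Ss" "snd z = (\<not> snd l)" for z
        using that l by (cases l) (simp add: act_w_def push_def)
      have 2: "act_w x w' \<noteq> []" "length (act_w x w') \<le> Suc (length w')"
        unfolding ax unfolding act_w_def using push_a_nonempty[OF valid(2) \<open>w' \<noteq> []\<close>] \<open>w' \<noteq> []\<close>
        by (auto simp: push_def split: list.splits)
      show ?thesis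
        using x False 2 \<open>w' \<noteq> []\<close> \<open>fst l = Sa\<close> by (auto simp: val q Cons 1)
    qed
  qed
qed

lemma flow_path_decreasing:
  assumes "nf_run y = Some q" "\<not> tree_edge (val y) x" "flow_path q x = p @ z # t"
    "\<not> tree_edge (val (y @ p)) z"
  shows "((val (y @ p), z), (val y, x)) \<in> simpler"
proof -
  obtain v w where vw: "val y = (v, w)" by fastforce
  have "descends (val y, x) (fold act_v p v, fold act_w p w) (z # t)"
    using flow_path_descends[OF assms(1,2)] unfolding assms(3) by (intro descends_append) (simp add: vw)
  then show ?thesis using assms(4) by (simp add: val_append vw)
qed

text \<open>The invariants separate the letters from each other and from the empty word.\<close>

lemma stallings_letters:
  "pres_eq SR [x] y \<Longrightarrow> y = [] \<or> y = [x'] \<Longrightarrow> y = [x]"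
  using val_eq[of "[x]" y] fold_act_u_eq[of "[x]" y "[]"]
  by (cases "fst x"; cases "fst x'") (auto simp: val_def act_u_def act_v_def act_w_def push_def)

theorem theorem4p1:
  shows "autostackable stallings_group"
proof -
  interpret presentation_flow SR nf_step "(None, False)" flow_path val tree_edge simpler
  proof
    show "finite (UNIV :: stallings_gen set)" by simp
    show "wf simpler" by (intro wf_inv_image wf_lex_prod wf_less_than)
  next
    fix x x' :: "stallings_gen \<times> bool"
    show "pres_eq SR [x] [x'] \<Longrightarrow> x = x'" using stallings_letters[of x "[x']" x'] by simp
    show "\<not> pres_eq SR [x] []" using stallings_letters[of x "[]"] by auto
  qed (fact nf_unique val_eq nf_tree_edge_iff flow_path_tree flow_path_eq flow_path_decreasing)+
  show ?thesis unfolding stallings_group_def by (rule autostackable_presentation)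
qed

end
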